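(* Let $p$ be a prime, $q=p^r$ with $r\ge1$, $n\ge1$ an integer, and let $f(x),g(x),h(x)\in\mathbf{F}_{q^2}[x]$ be monic polynomials of degree less than $n$ such that $f(x)$ and $g(x)$ divide $x^n-1$. Assume that $f(x)\mid g(x)\mid {g^{[q]}}^\perp(x)\mid {f^{[q]}}^\perp(x)$. Then the quasi-cyclic code $Q=Q_{q^2}(f,g,h)\subset\mathbf{F}_{q^2}^{2n}$ is self-orthogonal for the Hermitian inner product in the sense that $Q^{\perp_h}\subset Q$, and there exists a stabilizer quantum code with parameters $$[[2n,\ 2n-2\deg(f(x))-2\deg(g(x)),\ \ge d_{q^2}^e(f,g,h)]]_q,$$ where $$d_{q^2}^e(f,g,h)=\min\Big\{ d([g]),\ d\big([(x^n-1)/\gcd(x^n-1,h)]\big),\ d\big([\mathrm{lcm}(f,\,g/\gcd(g,h))]\big),\ d([f])+d([\gcd(hf,g)])\Big\}.$$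
   Context: Classical notation. $R=\mathbf{F}_{q^2}[x]/(x^n-1)$ and $[a(x)]$ is the class of $a(x)$ in $R$. A vector $(a_0,\ldots,a_{n-1})\in\mathbf{F}_{q^2}^n$ is identified with $[a_0+a_1x+\cdots+a_{n-1}x^{n-1}]\in R$, and $\mathbf{F}_{q^2}^{2n}$ is identified with $R^2$ accordingly (first $n$ coordinates, last $n$ coordinates). $Q_{q^2}(f,g,h)$ is the $R$-submodule of $R^2$ generated by $([f(x)],[h(x)f(x)])$ and $(0,[g(x)])$. For $u(x)=\sum_i a_ix^i$ put $u^{[q]}(x)=\sum_i a_i^qx^i$. For a divisor $u(x)$ of $x^n-1$, let $u'(x)$ be defined by $u(x)u'(x)=x^n-1$ and put $u^\perp(x)=x^{\deg u'}u'(1/x)$; ${f^{[q]}}^\perp$ and ${g^{[q]}}^\perp$ mean $(f^{[q]})^\perp$ and $(g^{[q]})^\perp$. $d([u(x)])$ is the minimum Hamming distance of the cyclic code (ideal of $R$) over $\mathbf{F}_{q^2}$ generated by $[u(x)]$, i.e. the minimum Hamming weight of its nonzero elements, with the convention that it is $+\infty$ if this code is zero. Hermitian inner product: $\langle\vec x,\vec y\rangle_h=\sum_i x_i^qy_i$, and $C^{\perp_h}=\{\vec x\mid\langle\vec x,\vec y\rangle_h=0\ \forall\,\vec y\in C\}$. Quantum codes. Let $\mathbf{C}^q$ have orthonormal basis $|u\rangle$, $u\in\mathbf{F}_q$, let $\omega=e^{2\pi i/p}$, let $\mathrm{tr}:\mathbf{F}_q\to\mathbf{F}_p$ be the trace,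 and put $X(a)|u\rangle=|u+a\rangle$, $Z(b)|u\rangle=\omega^{\mathrm{tr}(bu)}|u\rangle$ for $a,b\in\mathbf{F}_q$. The error group on $\mathbf{C}^{q^N}=(\mathbf{C}^q)^{\otimes N}$ consists of the operators $\omega^c\,X(a_1)Z(b_1)\otimes\cdots\otimes X(a_N)Z(b_N)$ with $c\in\mathbf{F}_p$, $a_i,b_i\in\mathbf{F}_q$; the weight of such an operator is the number of $i$ with $(a_i,b_i)\ne(0,0)$. A stabilizer code of length $N$ is a nonzero common eigenspace $\mathcal C$ of a commutative subgroup $S$ of the error group, i.e. $\mathcal C=\{v\mid Ev=\chi(E)v\ \forall E\in S\}$ for some character $\chi$ of $S$. It has parameters $[[N,k,\ge d]]_q$ if $\dim_{\mathbf C}\mathcal C=q^k$ and every error $E$ of weight less than $d$ is detectable or has no effect on $\mathcal C$, i.e. $PEP=c_EP$ for some scalar $c_E$, where $P$ is the orthogonal projector onto $\mathcal C$. *)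

theory Defs
  imports
    "HOL-Analysis.Analysis"
    "HOL-Computational_Algebra.Computational_Algebra"
    "HOL-Library.Extended_Nat"
    "HOL-Library.Function_Algebras"
    "HOL-Algebra.Group"
begin

section \<open>Cyclic and quasi-cyclic codes\<close>

text \<open>
  A word of length \<open>N\<close> over a field is a list of length \<open>N\<close>.
  A class \<open>[a(x)]\<close> in \<open>R = F[x]/(x^n - 1)\<close> is represented by the coefficient
  list of the unique representative of degree less than \<open>n\<close>; this is the usual identification
  of \<open>R\<close> with \<open>F^n\<close> (for \<open>n \<ge> 1\<close>).
\<close>

definition xn1 :: "nat \<Rightarrow> 'a::field poly"
  where "xn1 n = monom 1 n - 1"

definition cls :: "nat \<Rightarrow> 'a::field poly \<Rightarrow> 'a list"
  where "cls n a = map (coeff (a mod xn1 n)) [0..<n]"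

text \<open>The ideal of \<open>R\<close> generated by \<open>[u]\<close>.\<close>

definition cyclic_code :: "nat \<Rightarrow> 'a::field poly \<Rightarrow> 'a list set"
  where "cyclic_code n u = {cls n (a * u) | a. True}"

text \<open>
  The submodule of \<open>R^2\<close> generated by \<open>([f], [h f])\<close> and \<open>(0, [g])\<close>: its elements are
  \<open>[a] ([f], [h f]) + [b] (0, [g])\<close> with \<open>[a], [b]\<close> in \<open>R\<close>.
\<close>

definition qc_code :: "nat \<Rightarrow> 'a::field poly \<Rightarrow> 'a poly \<Rightarrow> 'a poly \<Rightarrow> 'a list set"
  where "qc_code n f g h = {cls n (a * f) @ cls n (a * (h * f) + b * g) | a b. True}"

definition hweight :: "'a::zero list \<Rightarrow> nat"
  where "hweight x = card {i. i < length x \<and> x ! i \<noteq> 0}"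

text \<open>Since \<open>Inf {} = \<infinity>\<close> in \<^typ>\<open>enat\<close>, the zero code has minimum distance \<open>\<infinity>\<close>.\<close>

definition min_dist :: "'a::zero list set \<Rightarrow> enat"
  where "min_dist C = Inf {enat (hweight x) | x. x \<in> C \<and> x \<noteq> replicate (length x) 0}"

definition cyc_dist :: "nat \<Rightarrow> 'a::field poly \<Rightarrow> enat"
  where "cyc_dist n u = min_dist (cyclic_code n u)"

definition frob_poly :: "nat \<Rightarrow> 'a::field poly \<Rightarrow> 'a poly"
  where "frob_poly q u = map_poly (\<lambda>a. a ^ q) u"

text \<open>
  For \<open>u\<close> dividing \<open>x^n - 1\<close> and \<open>u'\<close> the quotient, \<^const>\<open>reflect_poly\<close> yields
  \<open>x^(deg u') u'(1/x)\<close>.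
\<close>

definition perp_poly :: "nat \<Rightarrow> 'a::field poly \<Rightarrow> 'a poly"
  where "perp_poly n u = reflect_poly (xn1 n div u)"

definition herm_inner :: "nat \<Rightarrow> 'a::field list \<Rightarrow> 'a list \<Rightarrow> 'a"
  where "herm_inner q x y = (\<Sum>i<length x. (x ! i) ^ q * y ! i)"

definition herm_dual :: "nat \<Rightarrow> nat \<Rightarrow> 'a::field list set \<Rightarrow> 'a list set"
  where "herm_dual q N C = {x. length x = N \<and> (\<forall>y\<in>C. herm_inner q x y = 0)}"

definition de_bound ::
    "nat \<Rightarrow> 'a::field_gcd poly \<Rightarrow> 'a poly \<Rightarrow> 'a poly \<Rightarrow> enat"
  where "de_bound n f g h =
    Min {cyc_dist n g,
         cyc_dist n (xn1 n div gcd (xn1 n) h),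
         cyc_dist n (lcm f (g div gcd g h)),
         cyc_dist n f + cyc_dist n (gcd (h * f) g)}"


section \<open>Operators on \<open>\<complex>\<^sup>I\<close> for a finite index set \<open>I\<close>\<close>

text \<open>
  Vectors are functions vanishing off \<open>I\<close> and operators are matrices vanishing off
  \<open>I \<times> I\<close>, so that each vector and each operator has exactly one representation.
\<close>

type_synonym 'i ket = "'i \<Rightarrow> complex"
type_synonym 'i oper = "'i \<Rightarrow> 'i \<Rightarrow> complex"

definition kets :: "'i set \<Rightarrow> 'i ket set"
  where "kets I = {\<psi>. \<forall>u. u \<notin> I \<longrightarrow> \<psi> u = 0}"

definition opers :: "'i set \<Rightarrow> 'i oper set"
  where "opers I = {A. \<forall>u v. u \<notin> I \<or> v \<notin> I \<longrightarrow> A u v = 0}"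

definition op_id :: "'i set \<Rightarrow> 'i oper"
  where "op_id I = (\<lambda>u v. if u \<in> I \<and> u = v then 1 else 0)"

definition op_mult :: "'i set \<Rightarrow> 'i oper \<Rightarrow> 'i oper \<Rightarrow> 'i oper"
  where "op_mult I A B = (\<lambda>u w. \<Sum>v\<in>I. A u v * B v w)"

definition op_scale :: "complex \<Rightarrow> 'i oper \<Rightarrow> 'i oper"
  where "op_scale c A = (\<lambda>u v. c * A u v)"

definition op_adj :: "'i oper \<Rightarrow> 'i oper"
  where "op_adj A = (\<lambda>u v. cnj (A v u))"

definition op_apply :: "'i set \<Rightarrow> 'i oper \<Rightarrow> 'i ket \<Rightarrow> 'i ket"
  where "op_apply I A \<psi> = (\<lambda>u. \<Sum>v\<in>I. A u v * \<psi> v)"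

definition ket_scale :: "complex \<Rightarrow> 'i ket \<Rightarrow> 'i ket"
  where "ket_scale c \<psi> = (\<lambda>u. c * \<psi> u)"

interpretation ket: vector_space "ket_scale :: complex \<Rightarrow> 'i ket \<Rightarrow> 'i ket"
  by unfold_locales (auto simp: ket_scale_def fun_eq_iff algebra_simps)

definition orth_projector :: "'i set \<Rightarrow> 'i oper \<Rightarrow> 'i ket set \<Rightarrow> bool"
  where "orth_projector I P C \<longleftrightarrow>
    P \<in> opers I \<and> op_mult I P P = P \<and> op_adj P = P \<and> op_apply I P ` kets I = C"


section \<open>Error group and stabilizer codes\<close>

text \<open>
  In what follows the type \<open>'b\<close> is the field \<open>F_q\<close> with \<open>q = p^r\<close>, and the standard basis of
  \<open>(\<complex>^q)^{\<otimes>N}\<close> is indexed by \<open>words N\<close>.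
  The trace to \<open>F_p\<close> is a sum of conjugates, and \<open>fp_rep\<close> picks the representative in
  \<open>{0..<p}\<close> of an element of the prime field.
\<close>

definition words :: "nat \<Rightarrow> 'b list set"
  where "words N = {u. length u = N}"

definition ff_trace :: "nat \<Rightarrow> nat \<Rightarrow> 'b::field \<Rightarrow> 'b"
  where "ff_trace p r x = (\<Sum>i<r. x ^ (p ^ i))"

definition fp_rep :: "nat \<Rightarrow> 'b::field \<Rightarrow> nat"
  where "fp_rep p x = (THE k. k < p \<and> of_nat k = x)"

definition omega :: "nat \<Rightarrow> complex"
  where "omega p = exp (2 * of_real pi * \<i> / of_nat p)"

definition X_op :: "'b::field \<Rightarrow> 'b oper"
  where "X_op a = (\<lambda>u v. if u = v + a then 1 else 0)"

definition Z_op :: "nat \<Rightarrow> nat \<Rightarrow> 'b::field \<Rightarrow> 'b oper"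
  where "Z_op p r b =
    (\<lambda>u v. if u = v then omega p ^ fp_rep p (ff_trace p r (b * v)) else 0)"

definition tensor :: "nat \<Rightarrow> (nat \<Rightarrow> 'b oper) \<Rightarrow> 'b list oper"
  where "tensor N A =
    (\<lambda>u v. if u \<in> words N \<and> v \<in> words N then \<Prod>i<N. A i (u ! i) (v ! i) else 0)"

definition error_op ::
    "nat \<Rightarrow> nat \<Rightarrow> nat \<Rightarrow> nat \<Rightarrow> 'b::{finite,field} list \<Rightarrow> 'b list \<Rightarrow> 'b list oper"
  where "error_op p r N c a b =
    op_scale (omega p ^ c)
      (tensor N (\<lambda>i. op_mult UNIV (X_op (a ! i)) (Z_op p r (b ! i))))"

definition error_weight :: "nat \<Rightarrow> 'b::field list \<Rightarrow> 'b list \<Rightarrow> nat"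
  where "error_weight N a b = card {i. i < N \<and> (a ! i, b ! i) \<noteq> (0, 0)}"

definition error_group :: "nat \<Rightarrow> nat \<Rightarrow> nat \<Rightarrow> 'b::{finite,field} list oper monoid"
  where "error_group p r N =
    \<lparr>carrier = {error_op p r N c a b | c a b. c < p \<and> a \<in> words N \<and> b \<in> words N},
     monoid.mult = op_mult (words N), one = op_id (words N)\<rparr>"

definition complex_units :: "complex monoid"
  where "complex_units = \<lparr>carrier = UNIV - {0}, monoid.mult = (*), one = 1\<rparr>"

definition common_eigenspace ::
    "nat \<Rightarrow> 'b list oper set \<Rightarrow> ('b list oper \<Rightarrow> complex) \<Rightarrow> 'b list ket set"
  where "common_eigenspace N S \<rho> =
    {\<psi> \<in> kets (words N). \<forall>E\<in>S. op_apply (words N) E \<psi> = ket_scale (\<rho> E) \<psi>}"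

definition stabilizer_code ::
    "nat \<Rightarrow> nat \<Rightarrow> nat \<Rightarrow> 'b::{finite,field} list ket set \<Rightarrow> bool"
  where "stabilizer_code p r N C \<longleftrightarrow>
    (\<exists>S \<rho>. subgroup S (error_group p r N) \<and>
       (\<forall>E\<in>S. \<forall>F\<in>S. op_mult (words N) E F = op_mult (words N) F E) \<and>
       \<rho> \<in> hom ((error_group p r N)\<lparr>carrier := S\<rparr>) complex_units \<and>
       C = common_eigenspace N S \<rho> \<and> C \<noteq> {\<lambda>u. 0})"

text \<open>
  The parameters \<open>[[N, k, \<ge> d]]_q\<close> with \<open>q = p^r\<close>. The exponent \<open>k\<close> is an integer, so that
  differences of naturals are not truncated. The weight of an error does not depend on the
  chosen representation, because \<open>a\<close> and \<open>b\<close> are determined by the operator.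
\<close>

definition has_parameters ::
    "nat \<Rightarrow> nat \<Rightarrow> 'b::{finite,field} list ket set \<Rightarrow> nat \<Rightarrow> int \<Rightarrow> enat \<Rightarrow> bool"
  where "has_parameters p r C N k d \<longleftrightarrow>
    real (ket.dim C) = real (p ^ r) powi k \<and>
    (\<exists>P. orth_projector (words N) P C \<and>
       (\<forall>c a b. c < p \<and> a \<in> words N \<and> b \<in> words N \<and> enat (error_weight N a b) < d \<longrightarrow>
          (\<exists>z. op_mult (words N) (op_mult (words N) P (error_op p r N c a b)) P = op_scale z P)))"

end

theory Submission
  imports Defs "HOL-Number_Theory.Residues"
begin

text \<open>
  Since \<open>f\<close> divides \<open>g\<close>, the code \<open>Q\<close> contains the square of the cyclic code \<open>(g)\<close>. So the Hermitian
  dual \<open>K\<close> of \<open>Q\<close> lies in the square of the dual of \<open>(g)\<close>, which is generated by the perp polynomial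
  of \<open>g^[q]\<close> and hence contained in \<open>(g)\<close>; thus \<open>K \<subseteq> Q\<close>. A nonzero word of \<open>Q\<close> has its second half in
  \<open>(g)\<close> if the first half vanishes, its first half in \<open>(lcm(f, g/gcd(g,h)))\<close> if the second half
  vanishes, and otherwise halves in \<open>(f)\<close> and \<open>(gcd(hf,g))\<close>, which bounds its weight from below.

  In coordinates of \<open>F_{q^2}\<close> over \<open>F_q\<close> adapted to the form \<open>x^q y - x y^q\<close>, the words of \<open>K\<close> index commuting
  errors \<open>E\<^sub>x\<close>. They have a common eigenvector, whose eigenvalues \<open>\<rho>(x)\<close> make \<open>x \<mapsto> \<rho>(x)\<^sup>-\<^sup>1 E\<^sub>x\<close> a unitary
  representation of \<open>K\<close>. The average of this representation is the projector \<open>P\<close> onto the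
  stabilizer code, and the dimension is the trace of \<open>P\<close>. An error of weight below the minimum
  distance of \<open>Q\<close>, the dual of \<open>K\<close>, is a scalar or fails to commute with some \<open>E\<^sub>x\<close>; in the latter
  case \<open>P E P = 0\<close>.
\<close>

hide_const (open) up_ring.monom up_ring.coeff module.smult

section \<open>Finite fields\<close>

text \<open>The two fields are unrelated types, so an embedding of F_q into F_{q^2} has to be built.
  Integer polynomials, which can be evaluated in both fields, stand in for polynomials over the
  prime field.

  The errors attached to an isotropic group multiply only up to p-th roots of unity, and for p = 2
  even a single error such as XZ may square to -1. The eigenvalues at one common eigenvector obey
  the same multiplication rule, so dividing by them removes all phases at once, for every p and
  without choosing generators. The eigenvector exists because each error has finite order.

  Commutation of two errors says only that an additive character is trivial at their symplectic
  product. Since K is stable under scaling by F_{q^2}, a label commuting with all of K is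
  nevertheless Hermitian orthogonal to K, hence lies in the dual of K, which is Q. This is why the
  minimum distance of Q governs detection. Character sums give |Q| |K| = q^(4n), so |K| = q^(2 deg f
  + 2 deg g), and the code has dimension q^(2n) / |K|.\<close>

lemma CHAR_of_card_prime_power:
  assumes "prime p" and "CARD('a::{finite,field}) = p ^ r"
  shows "CHAR('a) = p"
proof -
  have "prime CHAR('a)"
    by (rule prime_CHAR_semidom) (simp add: finite_imp_CHAR_pos)
  moreover have "CHAR('a) dvd p ^ r"
    using CHAR_dvd_CARD[where 'a = 'a] assms(2) by simp
  ultimately show ?thesis
    using assms(1) by (metis prime_dvd_power primes_dvd_imp_eq)
qed

text \<open>Multiplication by a nonzero \<open>x\<close> permutes the nonzero elements, so their
  product is unchanged by the factor \<open>x ^ (CARD('a) - 1)\<close>.\<close>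

lemma power_card_field:
  fixes x :: "'a::{finite,field}"
  shows "x ^ CARD('a) = x"
proof (cases "x = 0")
  case False
  let ?U = "UNIV - {0::'a}"
  have "bij_betw ((*) x) ?U ?U"
    by (rule bij_betwI[where g = "\<lambda>y. y / x"]) (use False in auto)
  then have "prod (\<lambda>y. y) ?U = (\<Prod>y\<in>?U. x * y)"
    by (rule prod.reindex_bij_betw[symmetric])
  then have "prod (\<lambda>y. y) ?U * 1 = prod (\<lambda>y. y) ?U * x ^ (CARD('a) - 1)"
    by (simp add: prod.distrib mult.commute)
  then have "x ^ (CARD('a) - 1) = 1"
    by (subst (asm) mult_cancel_left) auto
  then show ?thesis
    using power_eq_if[of x "CARD('a)"] by simp
qed (simp add: finite_UNIV_card_ge_0)

text \<open>The type-class field is repackaged as a record-based ring \<open>R\<close>, so that the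
  cyclicity of the multiplicative group of a finite field can be applied to it.\<close>

lemma primitive_element:
  obtains t :: "'a::{finite,field}" where "\<And>x. x \<noteq> 0 \<Longrightarrow> \<exists>k::nat. x = t ^ k"
proof -
  define R :: "'a ring" where
    "R = \<lparr>carrier = UNIV, monoid.mult = (*), one = 1, zero = 0, add = (+)\<rparr>"
  have pow: "x [^]\<^bsub>R\<^esub> (k::nat) = x ^ k" for x k
    by (induction k) (auto simp: R_def nat_pow_def mult.commute)
  have "cring R"
  proof (rule cringI)
    show "abelian_group R"
      by (rule abelian_groupI) (auto simp: R_def ac_simps intro: exI[of _ "- x" for x])
    show "comm_monoid R"
      by (rule comm_monoidI) (auto simp: R_def ac_simps)
  qed (auto simp: R_def algebra_simps)
  then have "field R"
    by (rule cring.cring_fieldI2) (auto simp: R_def intro: right_inverse)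
  then obtain t where "carrier (mult_of R) = {t [^]\<^bsub>R\<^esub> k | k::nat. k \<in> UNIV}"
    using field.finite_field_mult_group_has_gen[of R] by (auto simp: R_def)
  then have "UNIV - {0} = {t ^ k | k. True}"
    by (simp add: pow) (simp add: R_def)
  then show thesis
    using that[of t] by blast
qed

section \<open>Embedding the small field into the large one through integer polynomials\<close>

lemma map_poly_add_hom:
  assumes "h 0 = 0" and "\<And>x y. h (x + y) = h x + h y"
  shows "map_poly h (p + q) = map_poly h p + map_poly h q"
  by (rule poly_eqI) (simp add: coeff_map_poly assms)

lemma map_poly_mult_hom:
  fixes h :: "'a::comm_semiring_0 \<Rightarrow> 'b::comm_semiring_0"
  assumes h0: "h 0 = 0" and hadd: "\<And>x y. h (x + y) = h x + h y"
    and hmult: "\<And>x y. h (x * y) = h x * h y"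
  shows "map_poly h (p * q) = map_poly h p * map_poly h q"
proof (rule poly_eqI)
  fix i
  have "h (sum f A) = (\<Sum>j\<in>A. h (f j))" for f :: "nat \<Rightarrow> 'a" and A
    by (induction A rule: infinite_finite_induct) (simp_all add: h0 hadd)
  then show "coeff (map_poly h (p * q)) i = coeff (map_poly h p * map_poly h q) i"
    by (simp add: coeff_map_poly h0 coeff_mult hmult)
qed

text \<open>The bridge between the two fields: every element of a finite field is the value of an
  integer polynomial at a primitive element, and the same polynomial can be evaluated in the other
  field.\<close>

definition int_eval :: "int poly \<Rightarrow> 'a::field \<Rightarrow> 'a"
  where "int_eval P x = poly (map_poly of_int P) x"

lemma int_eval_add: "int_eval (P + Q) x = int_eval P x + int_eval Q x"
  by (simp add: int_eval_def map_poly_add_hom[of of_int])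

lemma int_eval_mult: "int_eval (P * Q) x = int_eval P x * int_eval Q x"
  by (simp add: int_eval_def map_poly_mult_hom[of of_int])

lemma int_eval_0: "int_eval 0 x = 0"
  by (simp add: int_eval_def)

lemma int_eval_monom: "int_eval (monom c k) x = of_int c * x ^ k"
  by (simp add: int_eval_def map_poly_monom poly_monom)

lemma int_eval_diff: "int_eval (P - Q) x = int_eval P x - int_eval Q x"
  using int_eval_add[of "P - Q" Q x] by simp

text \<open>Induction on \<open>k\<close>, because the Frobenius map gives X^(q^(k+1)) - X =
  (X^(q^k) - X)^q + (X^q - X).\<close>

lemma power_card_poly_dvd:
  assumes "prime CHAR('a::field)" and "q = CHAR('a) ^ r"
  shows "(monom 1 q - monom 1 1 :: 'a::field poly) dvd monom 1 (q ^ k) - monom 1 1"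
proof (induction k)
  case (Suc k)
  let ?d = "\<lambda>j. monom 1 j - monom 1 1 :: 'a poly"
  have "(?d (q ^ k) + monom 1 1) ^ q = ?d (q ^ k) ^ q + monom 1 1 ^ q"
    by (rule freshmans_dream'[where n = r]) (simp_all add: assms)
  then have "?d (q ^ Suc k) = ?d (q ^ k) ^ q + ?d q"
    by (simp add: monom_power mult.commute algebra_simps)
  moreover have "?d (q ^ k) dvd ?d (q ^ k) ^ q"
    by (rule dvd_power) (use assms in \<open>auto simp: prime_gt_0_nat\<close>)
  ultimately show ?case
    by (simp only: dvd_add[OF dvd_trans[OF Suc.IH] dvd_refl])
qed simp

text \<open>Take for \<open>y\<close> a root in the large field of the minimal polynomial of
  \<open>t\<close> over the prime field. Such a root exists because this polynomial divides X^q - X,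
  hence X^(q^k) - X, which vanishes on the whole large field.\<close>

lemma int_eval_relations_root:
  fixes t :: "'b::{finite,field}"
  assumes p: "prime p" and q: "CARD('b) = p ^ r" "CARD('a::{finite,field}) = CARD('b) ^ k"
  obtains y :: "'a::{finite,field}" where "\<And>P. int_eval P t = 0 \<Longrightarrow> int_eval P y = 0"
proof -
  have Cb: "CHAR('b) = p" using CHAR_of_card_prime_power[OF p q(1)] .
  have Ca: "CHAR('a) = p" 
    by (rule CHAR_of_card_prime_power[OF p, of "r * k"]) (simp add: q power_mult)
  define q where "q = p ^ r"
  have q2: "q \<ge> 2"
  proof -
    have "card {0, 1 :: 'b} \<le> CARD('b)" by (rule card_mono) auto
    then show ?thesis by (simp add: q(1) q_def)
  qed
  let ?m = "\<lambda>P. map_poly of_int P :: 'a poly"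
  \<comment> \<open>An integer polynomial has zero image over either field exactly when
    \<open>p\<close> divides all its coefficients. A member of \<open>J\<close> whose image has
    least degree therefore plays the role of the minimal polynomial of \<open>t\<close>.\<close>
  define J where "J = {P. int_eval P t = 0 \<and> ?m P \<noteq> 0}"
  define Q :: "int poly" where "Q = monom 1 q - monom 1 1"
  have mdiff: "?m (P - P') = ?m P - ?m P'" for P P'
    by (rule poly_eqI) (simp add: coeff_map_poly)
  have mQ: "?m Q = monom 1 q - monom 1 1"
    by (simp add: Q_def mdiff map_poly_monom)
  have "coeff (?m Q) q = 1"
    using q2 by (simp add: mQ)
  moreover have "int_eval Q t = 0"
    using power_card_field[of t] by (simp add: Q_def int_eval_diff int_eval_monom q q_def)
  ultimately have "Q \<in> J"
    by (auto simp: J_def)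
  then obtain P0 where P0: "P0 \<in> J" and min: "\<And>P. P \<in> J \<Longrightarrow> degree (?m P0) \<le> degree (?m P)"
    using ex_has_least_nat[of "\<lambda>P. P \<in> J" Q "\<lambda>P. degree (?m P)"] by auto
  \<comment> \<open>Division with remainder modulo \<open>p\<close>: the leading coefficient of
    \<open>P0\<close> is inverted modulo \<open>p\<close> by an integer \<open>c\<close>, so the
    subtracted multiple of \<open>P0\<close> has integer coefficients and \<open>t\<close> stays a
    root.\<close>
  have dvd: "?m P0 dvd ?m P" if "int_eval P t = 0" for P
    using that
  proof (induction "degree (?m P)" arbitrary: P rule: less_induct)
    case less
    show ?case
    proof (cases "?m P = 0")
      case False
      with less min have deg: "degree (?m P0) \<le> degree (?m P)"
        by (auto simp: J_def)
      define a b d where "a = coeff P (degree (?m P))" and "b = coeff P0 (degree (?m P0))"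
        and "d = degree (?m P) - degree (?m P0)"
      have la: "lead_coeff (?m P) = of_int a" and lb: "lead_coeff (?m P0) = of_int b"
        by (simp_all add: a_def b_def coeff_map_poly)
      have "of_int b \<noteq> (0::'a)"
        using P0 lb by (metis (mono_tags, lifting) J_def leading_coeff_0_iff mem_Collect_eq)
      then have "\<not> int p dvd b"
        by (simp add: of_int_eq_0_iff_char_dvd Ca)
      then have "coprime b (int p)"
        using p by (metis coprime_commute prime_imp_coprime prime_nat_int_transfer)
      then obtain c where "[b * c = 1] (mod int p)"
        using cong_solve_coprime_int by blast
      then have "int p dvd b * c - 1"
        by (simp add: cong_iff_dvd_diff)
      then have "of_int (b * c - 1) = (0::'a)"
        by (simp only: of_int_eq_0_iff_char_dvd Ca)
      then have bc: "of_int b * of_int c = (1::'a)"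
        by (simp only: of_int_diff of_int_mult of_int_1 eq_iff_diff_eq_0[symmetric])
      define P' where "P' = P - monom (a * c) d * P0"
      have mP': "?m P' = ?m P - monom (of_int (a * c)) d * ?m P0"
        by (simp add: P'_def mdiff map_poly_mult_hom[of of_int] map_poly_monom)
      have "degree (monom (of_int (a * c)) d * ?m P0) \<le> d + degree (?m P0)"
        by (metis add_le_mono degree_monom_le degree_mult_le le_refl order_trans)
      then have "degree (?m P') \<le> degree (?m P)"
        unfolding mP' using deg by (intro degree_diff_le) (auto simp: d_def)
      moreover have "coeff (?m P') (degree (?m P)) = 0"
        using deg la lb bc by (simp add: mP' coeff_monom_mult d_def mult.assoc) (simp add: mult.commute)
      ultimately have "?m P' = 0 \<or> degree (?m P') < degree (?m P)"
        using eq_zero_or_degree_less by blast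
      moreover have "int_eval P' t = 0"
        using less.prems P0 by (simp add: P'_def int_eval_diff int_eval_mult J_def)
      ultimately have "?m P0 dvd ?m P'"
        using less.hyps by auto
      then have "?m P0 dvd ?m P' + monom (of_int (a * c)) d * ?m P0"
        by simp
      then show ?thesis
        by (simp add: mP')
    qed simp
  qed
  \<comment> \<open>If the image were constant, evaluating at \<open>t\<close> would show that
    \<open>p\<close> divides the constant coefficient too, and the image would be zero.\<close>
  have degpos: "degree (?m P0) \<noteq> 0"
  proof
    assume 0: "degree (?m P0) = 0"
    have hi: "int p dvd coeff P0 i" if "i > 0" for i
    proof -
      have "coeff (?m P0) i = 0"
        using 0 that by (simp add: coeff_eq_0)
      then show ?thesis
        by (simp add: coeff_map_poly of_int_eq_0_iff_char_dvd Ca)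
    qed
    have "map_poly of_int P0 = [:of_int (coeff P0 0) :: 'b:]"
    proof (rule poly_eqI)
      fix i
      show "coeff (map_poly of_int P0) i = coeff [:of_int (coeff P0 0) :: 'b:] i"
        using hi[of i] by (cases i) (simp_all add: coeff_map_poly of_int_eq_0_iff_char_dvd Cb)
    qed
    then have "int p dvd coeff P0 0"
      using P0 by (simp add: J_def int_eval_def of_int_eq_0_iff_char_dvd Cb)
    then have "?m P0 = 0"
      using hi by (intro poly_eqI) 
        (metis coeff_0 coeff_map_poly gr0I of_int_0 of_int_eq_0_iff_char_dvd Ca)
    with P0 show False
      by (simp add: J_def)
  qed
  have "?m P0 dvd monom 1 q - monom 1 1"
    using dvd[of Q] \<open>Q \<in> J\<close> by (simp add: J_def mQ)
  also have "\<dots> dvd monom 1 (q ^ k) - monom 1 1"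
    by (rule power_card_poly_dvd[of _ r]) (simp_all add: Ca p q_def)
  finally obtain s where s: "monom 1 (q ^ k) - monom 1 1 = ?m P0 * s"
    by (rule dvdE)
  have ca: "CARD('a) = q ^ k" using q by (simp add: q_def)
  have ca2: "q ^ k \<ge> 2"
  proof -
    have "card {0, 1 :: 'a} \<le> CARD('a)" by (rule card_mono) auto
    then show ?thesis by (simp add: ca)
  qed
  \<comment> \<open>Otherwise the cofactor \<open>s\<close> would vanish at all \<open>q ^ k\<close>
    elements, which exceeds its degree because \<open>P0\<close> has positive degree.\<close>
  have "\<exists>y. poly (?m P0) y = 0"
  proof (rule ccontr)
    assume no: "\<not> ?thesis"
    have co: "coeff (?m P0 * s) (q ^ k) = 1"
      using ca2 by (simp flip: s)
    then have "s \<noteq> 0" "?m P0 \<noteq> 0"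
      by auto
    have "poly s y = 0" for y
    proof -
      have "poly (?m P0 * s) y = 0"
        unfolding s[symmetric] using power_card_field[of y] by (simp add: poly_monom ca)
      then show ?thesis
        using no by simp
    qed
    then have "q ^ k \<le> degree s"
      using card_poly_roots_bound[OF \<open>s \<noteq> 0\<close>] by (simp add: ca)
    moreover have "degree (?m P0 * s) \<le> q ^ k"
      unfolding s[symmetric] using ca2 by (intro degree_diff_le) (auto simp: degree_monom_eq)
    ultimately show False
      using degpos \<open>s \<noteq> 0\<close> \<open>?m P0 \<noteq> 0\<close> by (simp add: degree_mult_eq)
  qed
  then obtain y where y: "poly (?m P0) y = 0" by blast
  have "int_eval P y = 0" if "int_eval P t = 0" for P
    using dvd[OF that] y by (auto simp: int_eval_def elim: dvdE)
  then show thesis ..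
qed

text \<open>The value of \<open>P\<close> at a primitive element \<open>t\<close> is sent to the
  value of \<open>P\<close> at \<open>y\<close>. This is well defined because every integer relation
  satisfied by \<open>t\<close> is satisfied by \<open>y\<close>.\<close>

lemma finite_field_embedding:
  assumes p: "prime p" and q: "CARD('b::{finite,field}) = p ^ r"
    and qa: "CARD('a::{finite,field}) = CARD('b) ^ k"
  obtains \<iota> :: "'b::{finite,field} \<Rightarrow> 'a::{finite,field}" where "\<iota> 1 = 1" "\<And>x y. \<iota> (x + y) = \<iota> x + \<iota> y"
    "\<And>x y. \<iota> (x * y) = \<iota> x * \<iota> y" "inj \<iota>"
proof -
  obtain t :: 'b where t: "\<And>x. x \<noteq> 0 \<Longrightarrow> \<exists>k::nat. x = t ^ k"
    using primitive_element by blast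
  obtain y :: 'a where y: "\<And>P. int_eval P t = 0 \<Longrightarrow> int_eval P y = 0"
    using int_eval_relations_root[OF p q qa] by blast
  have surj: "\<exists>P. int_eval P t = x" for x
  proof (cases "x = 0")
    case True
    then show ?thesis by (metis int_eval_0)
  next
    case False
    then obtain k where "x = t ^ k" using t by blast
    then have "int_eval (monom 1 k) t = x" by (simp add: int_eval_monom)
    then show ?thesis by blast
  qed
  define \<iota> where "\<iota> x = int_eval (SOME P. int_eval P t = x) y" for x
  have wd: "\<iota> (int_eval P t) = int_eval P y" for P
  proof -
    let ?P = "SOME P'. int_eval P' t = int_eval P t"
    have "int_eval ?P t = int_eval P t"
      by (rule someI) simp
    then have "int_eval (?P - P) y = 0"
      by (intro y) (simp add: int_eval_diff)
    then show ?thesis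
      by (simp add: \<iota>_def int_eval_diff)
  qed
  have 1: "\<iota> 1 = 1"
    using wd[of "monom 1 0"] by (simp only: int_eval_monom) simp
  have add: "\<iota> (u + v) = \<iota> u + \<iota> v" for u v
    using surj[of u] surj[of v] wd by (metis int_eval_add)
  have mult: "\<iota> (u * v) = \<iota> u * \<iota> v" for u v
    using surj[of u] surj[of v] wd by (metis int_eval_mult)
  have "inj \<iota>"
  proof (rule injI, rule ccontr)
    fix u v assume uv: "\<iota> u = \<iota> v" "u \<noteq> v"
    have "\<iota> u = \<iota> (u - v) + \<iota> v" using add[of "u - v" v] by simp
    then have "\<iota> (u - v) = 0" using uv by simp
    then have "\<iota> ((u - v) * inverse (u - v)) = 0" by (simp add: mult)
    then show False using uv 1 by simp
  qed
  with 1 add mult show thesis ..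
qed

section \<open>The trace and the additive character\<close>

lemma ff_trace_add:
  assumes "prime p" and "CARD('b::{finite,field}) = p ^ r"
  shows "ff_trace p r (x + y :: 'b) = ff_trace p r x + ff_trace p r y"
proof -
  have "(x + y) ^ p ^ i = x ^ p ^ i + y ^ p ^ i" for i
    by (rule freshmans_dream') (simp_all add: CHAR_of_card_prime_power[OF assms] assms)
  then show ?thesis
    by (simp add: ff_trace_def sum.distrib)
qed

text \<open>Raising to the \<open>p\<close>-th power rotates the conjugates. This places the trace
  in the prime field.\<close>

lemma ff_trace_power:
  assumes "prime p" and "CARD('b::{finite,field}) = p ^ r"
  shows "ff_trace p r (x :: 'b) ^ p = ff_trace p r x"
proof -
  have "ff_trace p r x ^ p = (\<Sum>i<r. (x ^ p ^ i) ^ p)"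
    unfolding ff_trace_def
    by (rule freshmans_dream_sum) (simp_all add: CHAR_of_card_prime_power[OF assms] assms)
  also have "\<dots> = (\<Sum>i<r. x ^ p ^ Suc i)"
    by (simp add: mult.commute flip: power_mult)
  also have "x ^ p ^ 0 + \<dots> = (\<Sum>i<Suc r. x ^ p ^ i)"
    by (rule sum.lessThan_Suc_shift[symmetric])
  then have "(\<Sum>i<r. x ^ p ^ Suc i) = (\<Sum>i<r. x ^ p ^ i)"
    using power_card_field[of x] assms(2) by simp
  finally show ?thesis
    by (simp add: ff_trace_def)
qed

lemma of_nat_inj_below_CHAR:
  assumes "of_nat i = (of_nat j :: 'b::field)" and "i < CHAR('b)" "j < CHAR('b)"
  shows "i = j"
proof -
  have "\<not> a < b" if "of_nat a = (of_nat b :: 'b)" "b < CHAR('b)" for a b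
    using that of_nat_eq_iff_char_dvd[of a b, where 'a = 'b] by (auto dest!: dvd_imp_le)
  from this[of i j] this[of j i] show ?thesis
    using assms by simp
qed

text \<open>X^p - X has at most \<open>p\<close> roots, and the images of the naturals below
  \<open>p\<close> already account for \<open>p\<close> of them.\<close>

lemma prime_field_rep:
  assumes "prime CHAR('b::field)" and "x ^ CHAR('b) = (x::'b)"
  shows "\<exists>k<CHAR('b). of_nat k = x"
proof -
  let ?p = "CHAR('b)"
  let ?P = "monom 1 ?p - monom 1 1 :: 'b poly"
  have p: "?p \<ge> 2"
    using assms(1) by (rule prime_ge_2_nat)
  then have "coeff ?P ?p \<noteq> 0"
    by simp
  then have "?P \<noteq> 0"
    by (metis coeff_0)
  have root: "poly ?P y = 0 \<longleftrightarrow> y ^ ?p = y" for y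
    by (simp add: poly_monom)
  have "card {y. poly ?P y = 0} \<le> degree ?P"
    using \<open>?P \<noteq> 0\<close> by (rule card_poly_roots_bound)
  also have "degree ?P \<le> ?p"
    using p by (intro degree_diff_le) (auto simp: degree_monom_eq)
  finally have "card {y. poly ?P y = 0} \<le> ?p" .
  moreover have "of_nat k ^ ?p = (of_nat k :: 'b)" for k
  proof (induction k)
    case (Suc k)
    then show ?case
      using freshmans_dream[of ?p "1::'b" "of_nat k"] assms(1) by simp
  qed (use p in simp)
  then have "of_nat ` {..<?p} \<subseteq> {y. poly ?P y = 0}"
    by (auto simp: poly_monom)
  moreover have "card (of_nat ` {..<?p} :: 'b set) = ?p"
    by (subst card_image) (auto intro: inj_onI dest: of_nat_inj_below_CHAR)
  ultimately have "of_nat ` {..<?p} = {y. poly ?P y = 0}"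
    using poly_roots_finite[OF \<open>?P \<noteq> 0\<close>] by (intro card_seteq) auto
  then have "x \<in> of_nat ` {..<?p}"
    using assms(2) root by blast
  then show ?thesis
    by auto
qed

lemma fp_rep:
  assumes "prime CHAR('b::field)" and "x ^ CHAR('b) = (x::'b)"
  shows "of_nat (fp_rep CHAR('b) x) = x" and "fp_rep CHAR('b) x < CHAR('b)"
proof -
  obtain k where k: "k < CHAR('b)" "of_nat k = x"
    using prime_field_rep[OF assms] by blast
  have "fp_rep CHAR('b) x < CHAR('b) \<and> of_nat (fp_rep CHAR('b) x) = x"
    unfolding fp_rep_def
    by (rule theI[of _ k]) (use k in \<open>auto intro: of_nat_inj_below_CHAR\<close>)
  then show "of_nat (fp_rep CHAR('b) x) = x" and "fp_rep CHAR('b) x < CHAR('b)"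
    by auto
qed

lemma omega_power: "omega p ^ k = exp (2 * of_real pi * \<i> * of_nat k / of_nat p)"
  by (simp add: omega_def mult_ac flip: exp_of_nat_mult)

lemma omega_power_eq_iff: "p > 0 \<Longrightarrow> omega p ^ j = omega p ^ k \<longleftrightarrow> j mod p = k mod p"
  unfolding omega_power by (rule complex_root_unity_eq) simp

lemma norm_omega: "norm (omega p) = 1"
proof -
  have "omega p = cis (2 * pi / of_nat p)"
    by (simp add: omega_def cis_conv_exp mult_ac)
  then show ?thesis by simp
qed

definition add_char :: "nat \<Rightarrow> nat \<Rightarrow> 'b::field \<Rightarrow> complex"
  where "add_char p r x = omega p ^ fp_rep p (ff_trace p r x)"

lemma norm_add_char: "norm (add_char p r x) = 1"
  by (simp add: add_char_def norm_power norm_omega)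

lemma add_char_nonzero [simp]: "add_char p r x \<noteq> 0"
  using norm_add_char[of p r x] by auto

text \<open>Instantiated for both fields: with exponent \<open>r\<close> for the errors over F_q,
  and with exponent \<open>2 * r\<close> for counting dual codes over F_{q^2}.\<close>

locale field_card_prime_power =
  fixes p r :: nat and field_type :: "'b::{finite,field} itself"
  assumes prime_p: "prime p" and card_field: "CARD('b) = p ^ r"
begin

abbreviation chi :: "'b \<Rightarrow> complex"
  where "chi \<equiv> add_char p r"

lemma CHAR_eq: "CHAR('b) = p"
  by (rule CHAR_of_card_prime_power[OF prime_p card_field])

lemma of_nat_fp_rep_trace: "of_nat (fp_rep p (ff_trace p r x)) = ff_trace p r (x::'b)"
  using fp_rep(1)[of "ff_trace p r x"] by (simp add: CHAR_eq prime_p ff_trace_power card_field)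

lemma fp_rep_trace_less: "fp_rep p (ff_trace p r (x::'b)) < p"
  using fp_rep(2)[of "ff_trace p r x"] by (simp add: CHAR_eq prime_p ff_trace_power card_field)

text \<open>Since the characteristic is \<open>p\<close>, congruence of exponents modulo
  \<open>p\<close> can be checked inside the field. Additivity of \<open>chi\<close> thereby reduces
  to additivity of the trace, without computing representatives.\<close>

lemma omega_power_eq:
  assumes "of_nat j = (of_nat k :: 'b)"
  shows "omega p ^ j = omega p ^ k"
proof -
  have "[j = k] (mod p)" if "j \<le> k" "of_nat j = (of_nat k :: 'b)" for j k
  proof (cases "j = k")
    case False
    then have "p dvd k - j"
      using that of_nat_eq_iff_char_dvd[of j k, where 'a = 'b] by (simp add: CHAR_eq)
    then show ?thesis
      using that(1) by (metis cong_altdef_nat cong_sym)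
  qed simp
  from this[of j k] this[of k j] have "[j = k] (mod p)"
    using assms by (metis cong_sym nle_le)
  then show ?thesis
    using prime_gt_0_nat[OF prime_p] by (simp add: omega_power_eq_iff cong_def)
qed

lemma chi_add: "chi (x + y) = chi x * chi y"
  unfolding add_char_def power_add[symmetric]
  by (rule omega_power_eq, simp only: of_nat_add of_nat_fp_rep_trace)
    (rule ff_trace_add[OF prime_p card_field])

lemma chi_0 [simp]: "chi 0 = 1"
  using chi_add[of 0 0] by simp

lemma chi_power_p: "chi x ^ p = 1"
proof -
  have "omega p ^ p = 1"
    using omega_power_eq[of p 0] by (simp flip: CHAR_eq)
  then show ?thesis
    by (simp add: add_char_def mult.commute flip: power_mult) (simp add: power_mult)
qed

lemma chi_sum: "chi (sum f A) = (\<Prod>i\<in>A. chi (f i))"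
  by (induction A rule: infinite_finite_induct) (simp_all add: chi_add)

lemma r_pos: "r > 0"
proof (rule ccontr)
  assume "\<not> r > 0"
  then have "CARD('b) = 1"
    by (simp add: card_field)
  moreover have "card {0, 1 :: 'b} \<le> CARD('b)"
    by (rule card_mono) auto
  ultimately show False
    by simp
qed

text \<open>The trace is a polynomial function of degree at most p^(r-1), with coefficient 1 at X,
  so it cannot vanish at all p^r elements.\<close>

lemma ff_trace_nonzero: "\<exists>x::'b. ff_trace p r x \<noteq> 0"
proof (rule ccontr)
  assume no: "\<not> ?thesis"
  define P :: "'b poly" where "P = (\<Sum>i<r. monom 1 (p ^ i))"
  have p: "p > 1"
    using prime_p by (rule prime_gt_1_nat)
  have "coeff P 1 = (\<Sum>i<r. if i = 0 then 1 else 0)"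
    unfolding P_def coeff_sum by (rule sum.cong) (use p in auto)
  also have "\<dots> = 1"
    using r_pos by simp
  finally have "P \<noteq> 0"
    by auto
  have "poly P x = ff_trace p r x" for x
    by (simp add: P_def poly_sum poly_monom ff_trace_def)
  then have "CARD('b) \<le> degree P"
    using no card_poly_roots_bound[OF \<open>P \<noteq> 0\<close>] by simp
  also have "degree P \<le> p ^ (r - 1)"
    unfolding P_def
    by (rule degree_sum_le) (use p in \<open>auto simp: degree_monom_eq intro: power_increasing\<close>)
  also have "\<dots> < p ^ r"
    using p r_pos by simp
  finally show False
    by (simp add: card_field)
qed

lemma chi_nontrivial:
  assumes "c \<noteq> 0"
  shows "\<exists>x. chi (c * x) \<noteq> 1"
proof -
  obtain x :: 'b where x: "ff_trace p r x \<noteq> 0"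
    using ff_trace_nonzero by blast
  have "fp_rep p (ff_trace p r x) \<noteq> 0"
    using of_nat_fp_rep_trace[of x] x by (metis of_nat_0)
  then have "chi x \<noteq> 1"
    using fp_rep_trace_less[of x] omega_power_eq_iff[of p "fp_rep p (ff_trace p r x)" 0]
    by (simp add: add_char_def)
  then have "chi (c * (x / c)) \<noteq> 1"
    using assms by simp
  then show ?thesis
    by blast
qed

end

section \<open>Words and Hermitian duality\<close>

definition wadd :: "'a::plus list \<Rightarrow> 'a list \<Rightarrow> 'a list"
  where "wadd x y = map2 (+) x y"

definition wscale :: "'a::times \<Rightarrow> 'a list \<Rightarrow> 'a list"
  where "wscale c x = map ((*) c) x"

definition wdot :: "'a::comm_ring list \<Rightarrow> 'a list \<Rightarrow> 'a"
  where "wdot x y = (\<Sum>i<length x. x ! i * y ! i)"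

abbreviation wzero :: "nat \<Rightarrow> 'a::zero list"
  where "wzero N \<equiv> replicate N 0"

lemma words_iff: "x \<in> words N \<longleftrightarrow> length x = N"
  by (simp add: words_def)

lemma wadd_words: "x \<in> words N \<Longrightarrow> y \<in> words N \<Longrightarrow> wadd x y \<in> words N"
  by (simp add: words_iff wadd_def)

lemma wscale_words: "x \<in> words N \<Longrightarrow> wscale c x \<in> words N"
  by (simp add: words_iff wscale_def)

lemma wzero_words: "wzero N \<in> words N"
  by (simp add: words_iff)

lemma wadd_nth: "x \<in> words N \<Longrightarrow> y \<in> words N \<Longrightarrow> i < N \<Longrightarrow> wadd x y ! i = x ! i + y ! i"
  by (simp add: words_iff wadd_def)

lemma wscale_nth: "x \<in> words N \<Longrightarrow> i < N \<Longrightarrow> wscale c x ! i = c * x ! i"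
  by (simp add: words_iff wscale_def)

lemma words_eqI:
  "x \<in> words N \<Longrightarrow> y \<in> words N \<Longrightarrow> (\<And>i. i < N \<Longrightarrow> x ! i = y ! i) \<Longrightarrow> x = y"
  by (simp add: words_iff nth_equalityI)

lemma wadd_comm:
  fixes x y :: "'a::ab_semigroup_add list"
  assumes "x \<in> words N" and "y \<in> words N"
  shows "wadd x y = wadd y x"
  by (rule words_eqI[of _ N]) (simp_all add: assms wadd_words wadd_nth[of _ N] add.commute)

lemma wadd_cancel:
  fixes x y :: "'a::ring_1 list"
  assumes "x \<in> words N" and "y \<in> words N"
  shows "wadd (wscale (- 1) x) (wadd x y) = y" and "wadd x (wadd (wscale (- 1) x) y) = y"
  by (auto intro!: words_eqI[of _ N]
      simp: assms wadd_words wscale_words wadd_nth[of _ N] wscale_nth[of _ N])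

lemma finite_words: "finite (words N :: 'a::finite list set)"
  using finite_lists_length_eq[of "UNIV :: 'a set" N] by (simp add: words_def)

lemma card_words: "card (words N :: 'a::finite list set) = CARD('a) ^ N"
  using card_lists_length_eq[of "UNIV :: 'a set" N] by (simp add: words_def)

text \<open>The standard vanishing argument for character sums: \<open>g\<close> will be a
  translation and \<open>c\<close> the value of the character at the shift.\<close>

lemma sum_eq_0_if_rotated:
  fixes f :: "'i \<Rightarrow> complex"
  assumes "bij_betw g S S" and "\<And>x. x \<in> S \<Longrightarrow> f (g x) = c * f x" and "c \<noteq> 1"
  shows "sum f S = 0"
proof -
  have "sum f S = (\<Sum>x\<in>S. f (g x))"
    using assms(1) by (rule sum.reindex_bij_betw[symmetric])
  also have "\<dots> = c * sum f S"
    by (simp add: assms(2) sum_distrib_left)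
  finally have "(1 - c) * sum f S = 0"
    by (simp add: algebra_simps)
  then show ?thesis
    using assms(3) by simp
qed

definition linear_code :: "nat \<Rightarrow> 'a::field list set \<Rightarrow> bool"
  where "linear_code N C \<longleftrightarrow> C \<subseteq> words N \<and> wzero N \<in> C \<and>
    (\<forall>x\<in>C. \<forall>y\<in>C. wadd x y \<in> C) \<and> (\<forall>c. \<forall>x\<in>C. wscale c x \<in> C)"

lemma linear_code_words: "linear_code N (words N)"
  by (auto simp: linear_code_def wadd_words wscale_words wzero_words)

lemma linear_code_shift:
  assumes "linear_code N C" and "s \<in> C"
  shows "bij_betw (wadd s) C C"
proof (rule bij_betwI)
  have mem: "x \<in> words N" if "x \<in> C" for x
    using assms(1) that by (auto simp: linear_code_def)
  show "wadd s \<in> C \<rightarrow> C" and "wadd (wscale (- 1) s) \<in> C \<rightarrow> C"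
    using assms by (auto simp: linear_code_def)
  show "wadd (wscale (- 1) s) (wadd s x) = x" and "wadd s (wadd (wscale (- 1) s) x) = x"
    if "x \<in> C" for x
    using that assms(2) mem by (auto simp: wadd_cancel[of _ N])
qed

lemma herm_inner_wadd_right:
  assumes "x \<in> words N" "y \<in> words N" "z \<in> words N"
  shows "herm_inner q x (wadd y z) = herm_inner q x y + herm_inner q x z"
proof -
  have "length x = N" using assms(1) by (simp add: words_iff)
  then show ?thesis
    by (simp add: herm_inner_def wadd_nth[of _ N] assms algebra_simps sum.distrib)
qed

lemma herm_inner_wscale_right:
  assumes "x \<in> words N" "y \<in> words N"
  shows "herm_inner q x (wscale c y) = c * herm_inner q x y"
proof -
  have "length x = N" using assms(1) by (simp add: words_iff)
  then show ?thesis
    by (simp add: herm_inner_def wscale_nth[of _ N] assms sum_distrib_left mult_ac)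
qed

section \<open>The Hermitian form over F_{q^2} and the size of dual codes\<close>

locale hermitian_space = field_card_prime_power p "2 * r" field_type
  for p r :: nat and field_type :: "'a::{finite,field} itself" +
  fixes q :: nat
  assumes q_eq: "q = p ^ r"
begin

lemma card_q: "CARD('a) = q\<^sup>2"
  by (simp add: card_field q_eq power_mult mult.commute)

lemma power_q_q: "((x::'a) ^ q) ^ q = x"
  using power_card_field[of x] by (simp add: card_q power2_eq_square flip: power_mult)

lemma power_q_add: "(x + y :: 'a) ^ q = x ^ q + y ^ q"
  by (rule freshmans_dream'[where n = r]) (simp_all add: CHAR_eq prime_p q_eq)

lemma power_q_sum: "(sum f A :: 'a) ^ q = (\<Sum>i\<in>A. f i ^ q)"
  by (rule freshmans_dream_sum'[where n = r]) (simp_all add: CHAR_eq prime_p q_eq)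

lemma q_pos: "q > 0"
  using prime_p by (simp add: q_eq prime_gt_0_nat)

lemma herm_inner_wadd_left:
  assumes "x \<in> words N" "y \<in> words N" "z \<in> words N"
  shows "herm_inner q (wadd x y) (z :: 'a list) = herm_inner q x z + herm_inner q y z"
proof -
  have "length x = N" "length y = N" "length (wadd x y) = N"
    using assms wadd_words[of x N y] by (simp_all add: words_iff)
  then show ?thesis
    by (simp add: herm_inner_def wadd_nth[of _ N] assms power_q_add algebra_simps sum.distrib)
qed

lemma herm_inner_wscale_left:
  assumes "x \<in> words N" "y \<in> words N"
  shows "herm_inner q (wscale c x) (y :: 'a list) = c ^ q * herm_inner q x y"
proof -
  have "length x = N" "length (wscale c x) = N"
    using assms wscale_words[of x N c] by (simp_all add: words_iff)
  then show ?thesis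
    by (simp add: herm_inner_def wscale_nth[of _ N] assms sum_distrib_left mult_ac power_mult_distrib)
qed

lemma herm_inner_swap:
  assumes "x \<in> words N" "y \<in> words N"
  shows "herm_inner q y x = herm_inner q x (y :: 'a list) ^ q"
  using assms
  by (simp add: herm_inner_def power_q_sum words_iff power_mult_distrib power_q_q mult.commute)

lemma herm_dual_iff:
  "x \<in> herm_dual q N C \<longleftrightarrow> x \<in> words N \<and> (\<forall>y\<in>C. herm_inner q x y = 0)"
  by (simp add: herm_dual_def words_iff)

lemma linear_code_herm_dual:
  assumes "C \<subseteq> words N"
  shows "linear_code N (herm_dual q N (C :: 'a list set))"
proof -
  have "herm_inner q (wzero N) y = 0" if "y \<in> C" for y
    using q_pos by (simp add: herm_inner_def zero_power)
  moreover have "y \<in> words N" if "y \<in> C" for y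
    using assms that by auto
  ultimately show ?thesis
    by (auto simp: linear_code_def herm_dual_iff wadd_words wscale_words wzero_words
        herm_inner_wadd_left[of _ N] herm_inner_wscale_left[of _ N])
qed

text \<open>Pairing with \<open>x\<close> gives an additive character of \<open>C\<close>. If some
  product with \<open>x\<close> is nonzero, scaling inside \<open>C\<close> turns it into any
  prescribed field value, in particular one where \<open>chi\<close> differs from 1.\<close>

lemma chi_herm_sum_code:
  assumes "linear_code N (C :: 'a list set)" and "x \<in> words N"
  shows "(\<Sum>y\<in>C. chi (herm_inner q x y)) = (if x \<in> herm_dual q N C then of_nat (card C) else 0)"
proof (cases "x \<in> herm_dual q N C")
  case False
  then obtain y where y: "y \<in> C" "herm_inner q x y \<noteq> 0"
    using assms(2) by (auto simp: herm_dual_iff)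
  have C: "C \<subseteq> words N"
    using assms(1) by (simp add: linear_code_def)
  obtain c where c: "chi (herm_inner q x y * c) \<noteq> 1"
    using chi_nontrivial[OF y(2)] by blast
  have s: "wscale c y \<in> C"
    using assms(1) y(1) by (simp add: linear_code_def)
  have "(\<Sum>y\<in>C. chi (herm_inner q x y)) = 0"
    using linear_code_shift[OF assms(1) s]
  proof (rule sum_eq_0_if_rotated)
    show "chi (herm_inner q x (wscale c y)) \<noteq> 1"
      using c y(1) C assms(2) by (simp add: herm_inner_wscale_right[of _ N] subset_iff mult.commute)
    fix z assume "z \<in> C"
    then show "chi (herm_inner q x (wadd (wscale c y) z))
        = chi (herm_inner q x (wscale c y)) * chi (herm_inner q x z)"
      using s C assms(2) by (simp add: herm_inner_wadd_right[of _ N] subset_iff chi_add)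
  qed
  then show ?thesis
    using False by simp
qed (simp add: herm_dual_iff)

lemma chi_herm_sum_words:
  assumes "y \<in> words N"
  shows "(\<Sum>x\<in>words N. chi (herm_inner q x y)) = (if y = wzero N then of_nat (CARD('a) ^ N) else 0)"
proof (cases "y = wzero N")
  case True
  then show ?thesis
    by (simp add: herm_inner_def words_iff card_words)
next
  case False
  then obtain i where i: "i < N" "y ! i \<noteq> 0"
    using words_eqI[OF assms wzero_words] by auto
  obtain t where t: "chi (y ! i * t) \<noteq> 1"
    using chi_nontrivial[OF i(2)] by blast
  \<comment> \<open>The entry is \<open>t ^ q\<close> because the form raises the left argument to
    the \<open>q\<close>-th power, and (t^q)^q = t.\<close>
  define s where "s = (wzero N)[i := t ^ q]"
  have s: "s \<in> words N"
    by (simp add: s_def words_iff)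
  have "herm_inner q s y = (\<Sum>j<N. if j = i then t * y ! i else 0)"
    unfolding herm_inner_def
    by (rule sum.cong) (use q_pos in \<open>auto simp: s_def nth_list_update power_q_q\<close>)
  then have sy: "herm_inner q s y = y ! i * t"
    using i by simp
  have "(\<Sum>x\<in>words N. chi (herm_inner q x y)) = 0"
    using linear_code_shift[OF linear_code_words s]
    by (rule sum_eq_0_if_rotated[where c = "chi (herm_inner q s y)"])
      (use s assms t sy in \<open>simp_all add: herm_inner_wadd_left[of _ N] chi_add\<close>)
  then show ?thesis
    using False by simp
qed

text \<open>Double counting of the sum of \<open>chi (herm_inner q x y)\<close> over all words
  \<open>x\<close> and all \<open>y\<close> in \<open>C\<close>: for fixed \<open>x\<close> only the
  dual contributes, for fixed \<open>y\<close> only the zero word.\<close>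

lemma card_herm_dual:
  assumes "linear_code N (C :: 'a list set)"
  shows "card C * card (herm_dual q N C) = CARD('a) ^ N"
proof -
  have C: "C \<subseteq> words N" "wzero N \<in> C"
    using assms by (simp_all add: linear_code_def)
  have fin: "finite C"
    using C(1) finite_words by (rule finite_subset)
  have "of_nat (card C * card (herm_dual q N C))
      = (\<Sum>x\<in>words N. if x \<in> herm_dual q N C then of_nat (card C) else 0 :: complex)"
    by (subst sum.inter_filter[symmetric])
      (auto simp: finite_words herm_dual_iff mult.commute intro!: arg_cong[where f = card])
  also have "\<dots> = (\<Sum>x\<in>words N. \<Sum>y\<in>C. chi (herm_inner q x y))"
    by (rule sum.cong) (simp_all add: chi_herm_sum_code[OF assms])
  also have "\<dots> = (\<Sum>y\<in>C. \<Sum>x\<in>words N. chi (herm_inner q x y))"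
    by (rule sum.swap)
  also have "\<dots> = (\<Sum>y\<in>C. if y = wzero N then of_nat (CARD('a) ^ N) else 0)"
    by (rule sum.cong) (use C in \<open>auto simp: chi_herm_sum_words\<close>)
  also have "\<dots> = of_nat (CARD('a) ^ N)"
    using C fin by simp
  finally show ?thesis
    by (simp only: of_nat_eq_iff)
qed

text \<open>\<open>C\<close> lies in its bidual, and \<open>card_herm_dual\<close>, applied to
  \<open>C\<close> and to its dual, shows that both have the same size.\<close>

lemma herm_dual_herm_dual:
  assumes "linear_code N (C :: 'a list set)"
  shows "herm_dual q N (herm_dual q N C) = C"
proof -
  let ?D = "herm_dual q N C"
  have C: "C \<subseteq> words N"
    using assms by (simp add: linear_code_def)
  have D: "linear_code N ?D"
    by (rule linear_code_herm_dual[OF C])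
  have "card C * card ?D = card (herm_dual q N ?D) * card ?D"
    using card_herm_dual[OF assms] card_herm_dual[OF D] by (simp add: mult.commute)
  moreover have "card ?D \<noteq> 0"
    using card_herm_dual[OF assms] by (intro notI) simp
  ultimately have "card C = card (herm_dual q N ?D)"
    by simp
  moreover have "finite (herm_dual q N ?D)"
    by (rule finite_subset[OF _ finite_words[of N]]) (auto simp: herm_dual_iff)
  moreover have "C \<subseteq> herm_dual q N ?D"
  proof
    fix x assume x: "x \<in> C"
    have "herm_inner q x y = 0" if "y \<in> ?D" for y
      using herm_inner_swap[of y N x] that x C q_pos by (auto simp: herm_dual_iff)
    then show "x \<in> herm_dual q N ?D"
      using x C by (auto simp: herm_dual_iff)
  qed
  ultimately show ?thesis
    by (metis card_subset_eq)
qed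

end

section \<open>Quasi-cyclic codes\<close>

lemma xn1_coeff: "coeff (xn1 n) i = (if i = n then 1 else 0) - (if i = 0 then 1 else 0)"
  unfolding xn1_def monom_eq_1[symmetric] by auto

lemma degree_xn1 [simp]: "degree (xn1 n) = n"
proof (cases "n = 0")
  case False
  have "degree (xn1 n) \<le> n"
    unfolding xn1_def by (intro degree_diff_le) (simp_all add: degree_monom_le)
  moreover have "n \<le> degree (xn1 n)"
    using False by (intro le_degree) (simp add: xn1_coeff)
  ultimately show ?thesis
    by (rule antisym)
qed (simp add: xn1_def monom_0 flip: one_pCons)

lemma xn1_nonzero: "n \<ge> 1 \<Longrightarrow> xn1 n \<noteq> 0"
  by (metis degree_0 degree_xn1 not_one_le_zero)

lemma cls_words: "cls n a \<in> words n"
  by (simp add: cls_def words_iff)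

lemma cls_nth: "i < n \<Longrightarrow> cls n a ! i = coeff (a mod xn1 n) i"
  by (simp add: cls_def)

lemma cls_add: "cls n (a + b) = wadd (cls n a) (cls n b)"
  by (rule words_eqI[of _ n])
    (simp_all add: cls_words wadd_words wadd_nth[of _ n] cls_nth poly_mod_add_left)

lemma cls_smult: "cls n (smult c a) = wscale c (cls n a)"
  by (rule words_eqI[of _ n])
    (simp_all add: cls_words wscale_words wscale_nth[of _ n] cls_nth mod_smult_left)

lemma cls_cong: "xn1 n dvd a - b \<Longrightarrow> cls n a = cls n b"
  unfolding cls_def by (metis mod_eq_dvd_iff)

lemma cls_small:
  assumes "degree a < n"
  shows "cls n a = map (coeff a) [0..<n]"
  using assms by (simp add: cls_def mod_poly_less)

lemma degree_mod_xn1: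
  assumes "n \<ge> 1"
  shows "degree (a mod xn1 n) < n"
  using degree_mod_less'[of "xn1 n" a] xn1_nonzero[OF assms] assms
  by (cases "a mod xn1 n = 0") auto

lemma cls_eq_0_iff:
  assumes "n \<ge> 1"
  shows "cls n a = wzero n \<longleftrightarrow> xn1 n dvd a"
proof
  assume "cls n a = wzero n"
  then have "coeff (a mod xn1 n) i = 0" if "i < n" for i
    using that cls_nth[of i n a] by simp
  moreover have "coeff (a mod xn1 n) i = 0" if "i \<ge> n" for i
    using degree_mod_xn1[OF assms, of a] that by (simp add: coeff_eq_0)
  ultimately have "a mod xn1 n = 0"
    by (intro poly_eqI) (metis coeff_0 not_le)
  then show "xn1 n dvd a"
    by (simp add: mod_eq_0_iff_dvd)
qed (auto intro: words_eqI[of _ n] simp: cls_words wzero_words cls_nth mod_eq_0_iff_dvd)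

lemma cls_eq_iff:
  assumes "n \<ge> 1"
  shows "cls n a = cls n b \<longleftrightarrow> xn1 n dvd a - b"
proof
  assume *: "cls n a = cls n b"
  have "cls n (a - b) = wzero n"
  proof (rule words_eqI[of _ n])
    fix i assume "i < n"
    then show "cls n (a - b) ! i = wzero n ! i"
      using cls_nth[of i n a] cls_nth[of i n b] *
      by (simp add: cls_nth poly_mod_diff_left)
  qed (simp_all add: cls_words wzero_words)
  then show "xn1 n dvd a - b"
    by (simp add: cls_eq_0_iff[OF assms])
qed (rule cls_cong)

lemma cls_Poly:
  assumes "x \<in> words n" and "n \<ge> 1"
  shows "cls n (Poly x) = x" and "degree (Poly x) < n"
proof -
  have len: "length x = n"
    using assms(1) by (simp add: words_iff)
  have "degree (Poly x) \<le> n - 1"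
    by (rule degree_le) (use len assms(2) in \<open>auto simp: nth_default_def\<close>)
  then show "degree (Poly x) < n"
    using assms(2) by simp
  then show "cls n (Poly x) = x"
    by (auto simp: cls_small nth_default_def len intro: nth_equalityI)
qed

lemma cls_in_cyclic_code: "u dvd a \<Longrightarrow> cls n a \<in> cyclic_code n u"
  by (auto simp: cyclic_code_def elim!: dvdE intro: exI[of _ k for k] simp: mult.commute)

lemma qc_codeI: "cls n (a * f) @ cls n (a * (h * f) + b * g) \<in> qc_code n f g h"
  by (auto simp: qc_code_def)

lemma wadd_append: "length x = length y \<Longrightarrow> wadd (x @ x') (y @ y') = wadd x y @ wadd x' y'"
  by (simp add: wadd_def)

lemma wscale_append: "wscale c (x @ y) = wscale c x @ wscale c y"
  by (simp add: wscale_def)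

lemma linear_code_qc_code: "linear_code (2 * n) (qc_code n f g h)"
proof -
  have "cls n 0 = wzero n"
    by (auto intro: words_eqI[of _ n] simp: cls_words wzero_words cls_nth)
  then have "wzero (2 * n) \<in> qc_code n f g h"
    using qc_codeI[of n 0 f h 0 g] by (metis add_0 mult_2 mult_zero_left replicate_add)
  moreover have "wadd x y \<in> qc_code n f g h"
    if xy: "x \<in> qc_code n f g h" "y \<in> qc_code n f g h" for x y
  proof -
    obtain a b a' b' where
      x: "x = cls n (a * f) @ cls n (a * (h * f) + b * g)" and
      y: "y = cls n (a' * f) @ cls n (a' * (h * f) + b' * g)"
      using xy by (auto simp: qc_code_def)
    have "wadd x y = wadd (cls n (a * f)) (cls n (a' * f))
        @ wadd (cls n (a * (h * f) + b * g)) (cls n (a' * (h * f) + b' * g))"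
      unfolding x y by (rule wadd_append) (simp add: cls_def)
    also have "\<dots> = cls n ((a + a') * f) @ cls n ((a + a') * (h * f) + (b + b') * g)"
      by (simp add: algebra_simps flip: cls_add)
    finally show ?thesis
      by (simp only: qc_codeI)
  qed
  moreover have "wscale c x \<in> qc_code n f g h" if x: "x \<in> qc_code n f g h" for c x
  proof -
    obtain a b where x: "x = cls n (a * f) @ cls n (a * (h * f) + b * g)"
      using x by (auto simp: qc_code_def)
    have "wscale c x = cls n (smult c a * f) @ cls n (smult c a * (h * f) + smult c b * g)"
      by (simp add: x wscale_append smult_add_right flip: cls_smult)
    then show ?thesis
      by (simp only: qc_codeI)
  qed
  ultimately show ?thesis
    by (auto simp: linear_code_def qc_code_def words_iff cls_def)
qed

section \<open>Size of a quasi-cyclic code\<close>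

text \<open>Phrased through coefficients and not as \<open>degree a < k\<close>, because the zero
  polynomial has degree 0 and would be lost for \<open>k = 0\<close>.\<close>

definition small_polys :: "nat \<Rightarrow> 'a::zero poly set"
  where "small_polys k = {a. \<forall>i\<ge>k. coeff a i = 0}"

lemma card_small_polys: "card (small_polys k :: 'a::{finite,zero} poly set) = CARD('a) ^ k"
proof -
  have "bij_betw (\<lambda>a. map (coeff a) [0..<k]) (small_polys k) (words k :: 'a list set)"
  proof (rule bij_betwI[where g = Poly])
    show "Poly \<in> words k \<rightarrow> small_polys k"
      by (auto simp: small_polys_def words_iff nth_default_def)
    show "Poly (map (coeff a) [0..<k]) = a" if "a \<in> small_polys k" for a :: "'a poly"
      using that by (intro poly_eqI) (auto simp: small_polys_def nth_default_def not_less)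
    show "map (coeff (Poly x)) [0..<k] = x" if "x \<in> words k" for x :: "'a list"
      using that by (auto simp: words_iff nth_default_def intro: nth_equalityI)
  qed (auto simp: words_iff)
  then show ?thesis
    by (simp add: bij_betw_same_card card_words)
qed

text \<open>A nonzero \<open>a\<close> would make \<open>a * u\<close> a nonzero polynomial of
  degree below \<open>n\<close>.\<close>

lemma small_polys_mult_dvd_xn1:
  assumes "a \<in> small_polys (n - degree u)" and "degree u < n" and "u \<noteq> 0"
    and "xn1 n dvd a * u"
  shows "a = (0::'a::field poly)"
proof (rule ccontr)
  assume a: "a \<noteq> 0"
  then have "degree a < n - degree u"
    using assms(1) by (metis (mono_tags, lifting) leading_coeff_0_iff linorder_not_le mem_Collect_eq small_polys_def)
  then have "degree (a * u) < degree (xn1 n :: 'a poly)"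
    using a assms(2,3) by (simp add: degree_mult_eq)
  then show False
    using assms(3,4) a dvd_imp_degree_le[of "xn1 n" "a * u"] by simp
qed

lemma small_polys_diff: "a \<in> small_polys k \<Longrightarrow> b \<in> small_polys k \<Longrightarrow> a - b \<in> small_polys k"
  for a b :: "'a::ab_group_add poly"
  by (simp add: small_polys_def)

text \<open>Reduce \<open>a\<close> modulo the cofactor of \<open>u\<close> in x^n - 1: the
  discarded multiple of the cofactor becomes a multiple of x^n - 1 once it is multiplied by
  \<open>u\<close>.\<close>

lemma reduce_multiplier:
  assumes "u dvd xn1 n" and "degree u < n"
  obtains a0 k where "a0 \<in> small_polys (n - degree u)" and "a * u = a0 * u + k * xn1 n"
proof -
  obtain u' where u': "xn1 n = u * u'"
    using assms(1) by (rule dvdE)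
  have "n \<ge> 1"
    using assms(2) by simp
  then have "u \<noteq> 0" "u' \<noteq> 0"
    using u' xn1_nonzero[of n] by auto
  then have deg: "degree u' = n - degree u"
    using arg_cong[OF u', of degree] by (simp add: degree_mult_eq)
  then have "degree (a mod u') < n - degree u"
    using degree_mod_less'[of u' a] \<open>u' \<noteq> 0\<close> assms(2) by (cases "a mod u' = 0") auto
  then have "a mod u' \<in> small_polys (n - degree u)"
    by (auto simp: small_polys_def intro: coeff_eq_0)
  moreover have "a * u = (a div u' * u' + a mod u') * u"
    by simp
  then have "a * u = a mod u' * u + a div u' * xn1 n"
    by (simp only: u' algebra_simps)
  ultimately show thesis
    using that by blast
qed

text \<open>With multipliers reduced to degrees below n - deg f and n - deg g, the first half of a
  codeword determines \<open>a\<close>, and then the second half determines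
  \<open>b\<close>.\<close>

lemma card_qc_code:
  fixes f g h :: "'a::{finite,field} poly"
  assumes f: "f dvd xn1 n" "degree f < n" and g: "g dvd xn1 n" "degree g < n"
  shows "card (qc_code n f g h) = CARD('a) ^ (n - degree f + (n - degree g))"
proof -
  have n: "n \<ge> 1"
    using f(2) by simp
  have f0: "f \<noteq> 0" and g0: "g \<noteq> 0"
    using f g xn1_nonzero[OF n] by auto
  let ?e = "\<lambda>(a, b). cls n (a * f) @ cls n (a * (h * f) + b * g)"
  let ?S = "small_polys (n - degree f) \<times> small_polys (n - degree g) :: ('a poly \<times> 'a poly) set"
  have inj: "inj_on ?e ?S"
  proof (rule inj_onI, clarify)
    fix a b a' b'
    assume S: "a \<in> small_polys (n - degree f)" "a' \<in> small_polys (n - degree f)"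
      "b \<in> small_polys (n - degree g)" "b' \<in> small_polys (n - degree g)"
      and eq: "cls n (a * f) @ cls n (a * (h * f) + b * g)
        = cls n (a' * f) @ cls n (a' * (h * f) + b' * g)"
    have eq1: "cls n (a * f) = cls n (a' * f)"
      and eq2: "cls n (a * (h * f) + b * g) = cls n (a' * (h * f) + b' * g)"
      using eq by (auto simp: cls_def append_eq_append_conv)
    have "xn1 n dvd (a - a') * f"
      using eq1 by (simp add: cls_eq_iff[OF n] left_diff_distrib)
    then have "a - a' = 0"
      by (rule small_polys_mult_dvd_xn1[OF small_polys_diff[OF S(1,2)] f(2) f0])
    then have "a = a'"
      by simp
    with eq2 have "xn1 n dvd (b - b') * g"
      by (simp add: cls_eq_iff[OF n] left_diff_distrib)
    then have "b - b' = 0"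
      by (rule small_polys_mult_dvd_xn1[OF small_polys_diff[OF S(3,4)] g(2) g0])
    with \<open>a = a'\<close> show "a = a' \<and> b = b'"
      by simp
  qed
  have img: "?e ` ?S = qc_code n f g h"
  proof
    show "qc_code n f g h \<subseteq> ?e ` ?S"
    proof
      fix x assume "x \<in> qc_code n f g h"
      then obtain a b where x: "x = cls n (a * f) @ cls n (a * (h * f) + b * g)"
        by (auto simp: qc_code_def)
      obtain a0 k where a0: "a0 \<in> small_polys (n - degree f)" "a * f = a0 * f + k * xn1 n"
        by (rule reduce_multiplier[OF f])
      obtain b0 l where b0: "b0 \<in> small_polys (n - degree g)" "b * g = b0 * g + l * xn1 n"
        by (rule reduce_multiplier[OF g])
      have "cls n (a * f) = cls n (a0 * f)"
        by (rule cls_cong) (simp add: a0)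
      \<comment> \<open>Reducing \<open>a\<close> also changes the second half, but only by
        \<open>h\<close> times the same multiple of x^n - 1.\<close>
      moreover have "a * (h * f) + b * g - (a0 * (h * f) + b0 * g)
          = h * (a * f - a0 * f) + (b * g - b0 * g)"
        by (simp add: algebra_simps)
      then have "a * (h * f) + b * g - (a0 * (h * f) + b0 * g) = (h * k + l) * xn1 n"
        unfolding a0(2) b0(2) by (simp only: add_diff_cancel_left' distrib_right mult.assoc)
      then have "xn1 n dvd a * (h * f) + b * g - (a0 * (h * f) + b0 * g)"
        by (simp only: dvd_triv_right)
      then have "cls n (a * (h * f) + b * g) = cls n (a0 * (h * f) + b0 * g)"
        by (rule cls_cong)
      ultimately show "x \<in> ?e ` ?S"
        using a0 b0 by (auto simp: x intro!: image_eqI[of _ _ "(a0, b0)"])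
    qed
  qed (auto simp: qc_codeI)
  have "card (qc_code n f g h) = card ?S"
    using card_image[OF inj] by (simp only: img)
  then show ?thesis
    by (simp add: card_cartesian_product card_small_polys power_add)
qed

subsection \<open>Self-orthogonality\<close>

lemma reflect_xn1: "n \<ge> 1 \<Longrightarrow> reflect_poly (xn1 n) = 1 - monom 1 n"
  unfolding monom_eq_1[symmetric]
  by (rule poly_eqI) (auto simp: coeff_reflect_poly xn1_coeff)

text \<open>
  With \<open>W\<close> the product of \<open>U\<close> and the reflection of \<open>G\<close>, the orthogonality relations say that
  the coefficients of \<open>W\<close> between \<open>deg G\<close> and \<open>n\<close> vanish. So modulo \<open>x^n\<close> the polynomial \<open>W\<close>
  agrees with some \<open>A\<close> of degree less than \<open>deg G\<close>, and comparing both sides of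
  \<open>U (1 - x^n) = W reflect(G')\<close> modulo \<open>x^n\<close> gives \<open>U = A reflect(G')\<close>.
\<close>

lemma orthogonal_imp_reflect_dvd:
  fixes U G G' :: "'a::field poly"
  assumes GG': "xn1 n = G * G'" and n: "n \<ge> 1" and U: "degree U < n"
    and orth: "\<And>j. j < n - degree G \<Longrightarrow> (\<Sum>i<n. coeff U i * coeff (monom 1 j * G) i) = 0"
  shows "reflect_poly G' dvd U"
proof -
  let ?d = "degree G" and ?H = "reflect_poly G'"
  define W where "W = U * reflect_poly G"
  define A where "A = poly_cutoff ?d W"
  have "G \<noteq> 0" "G' \<noteq> 0"
    using GG' xn1_nonzero[OF n, where 'a = 'a] by auto
  then have deg: "degree G + degree G' = n"
    using arg_cong[OF GG', of degree] by (simp add: degree_mult_eq)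
  have W0: "coeff W i = 0" if i: "?d \<le> i" "i < n" for i
  proof -
    define j where "j = i - ?d"
    have j: "i = j + ?d" "j < n - ?d"
      using i by (auto simp: j_def)
    have "coeff W i = (\<Sum>k\<le>i. coeff U k * coeff (reflect_poly G) (i - k))"
      by (simp add: W_def coeff_mult)
    also have "\<dots> = (\<Sum>k<n. coeff U k * coeff (monom 1 j * G) k)"
      using i(2)
      by (intro sum.mono_neutral_cong_left)
        (auto simp: coeff_monom_mult coeff_reflect_poly j coeff_eq_0 intro!: arg_cong[where f = "coeff G"])
    finally show ?thesis
      using orth[OF j(2)] by simp
  qed
  have "U * (1 - monom 1 n) = W * ?H"
    by (simp add: W_def mult.assoc flip: reflect_poly_mult GG' reflect_xn1[OF n])
  moreover have "coeff (U * (1 - monom 1 n)) i = coeff U i" if "i < n" for i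
    using that coeff_monom_mult[of 1 n U i] by (simp add: algebra_simps)
  moreover have "coeff (W * ?H) i = coeff (A * ?H) i" if "i < n" for i
    unfolding coeff_mult
    by (rule sum.cong) (use that W0 in \<open>auto simp: A_def coeff_poly_cutoff not_less\<close>)
  ultimately have low: "coeff U i = coeff (A * ?H) i" if "i < n" for i
    using that by metis
  have high: "coeff (A * ?H) i = 0" if "n \<le> i" for i
  proof (cases "A = 0")
    case False
    then have "degree A < ?d"
      using leading_coeff_0_iff[of A] by (metis A_def coeff_poly_cutoff)
    then have "degree (A * ?H) < n"
      using degree_mult_le[of A ?H] degree_reflect_poly_le[of G'] deg by linarith
    then show ?thesis
      using that by (simp add: coeff_eq_0)
  qed simp
  have "U = A * ?H"
  proof (rule poly_eqI)
    fix i
    show "coeff U i = coeff (A * ?H) i"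
      using low[of i] high[of i] U by (cases "i < n") (auto simp: coeff_eq_0)
  qed
  then show ?thesis
    by simp
qed

context hermitian_space
begin

lemma power_q_0: "(0::'a) ^ q = 0"
  using q_pos by simp

lemma frob_poly_mult: "frob_poly q (a * b :: 'a poly) = frob_poly q a * frob_poly q b"
  unfolding frob_poly_def
  by (rule map_poly_mult_hom) (simp_all add: power_q_0 power_q_add power_mult_distrib)

lemma coeff_frob_poly: "coeff (frob_poly q (a :: 'a poly)) i = coeff a i ^ q"
  by (simp add: frob_poly_def coeff_map_poly power_q_0)

lemma frob_poly_xn1: "frob_poly q (xn1 n :: 'a poly) = xn1 n"
proof (rule poly_eqI)
  fix i
  \<comment> \<open>Additivity of the \<open>q\<close>-th power gives this in every characteristic,
    including 2.\<close>
  have "(- 1 :: 'a) ^ q = - 1"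
    using power_q_add[of "- 1" 1] power_q_0 by (simp add: eq_neg_iff_add_eq_0)
  then show "coeff (frob_poly q (xn1 n :: 'a poly)) i = coeff (xn1 n) i"
    by (simp add: coeff_frob_poly xn1_coeff power_q_0)
qed

lemma degree_frob_poly: "degree (frob_poly q (a :: 'a poly)) = degree a"
  unfolding frob_poly_def by (rule degree_map_poly) (use q_pos in auto)

text \<open>Hermitian orthogonality of \<open>u\<close> to the shifts x^j g is bilinear
  orthogonality to x^j g^[q]. So the polynomial of \<open>u\<close> is a multiple of the reflected
  cofactor of g^[q], which is the perp polynomial, and \<open>g\<close> divides that.\<close>

lemma herm_dual_cyclic_code_subset:
  fixes g :: "'a poly"
  assumes g: "g dvd xn1 n" "degree g < n" and perp: "g dvd perp_poly n (frob_poly q g)"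
  shows "herm_dual q n (cyclic_code n g) \<subseteq> cyclic_code n g"
proof
  fix u assume u: "u \<in> herm_dual q n (cyclic_code n g)"
  let ?G = "frob_poly q g"
  have n: "n \<ge> 1"
    using g(2) by simp
  have un: "u \<in> words n"
    using u by (simp add: herm_dual_iff)
  obtain g' where "xn1 n = g * g'"
    using g(1) by (rule dvdE)
  then have GG': "xn1 n = ?G * frob_poly q g'"
    by (metis frob_poly_mult frob_poly_xn1)
  then have "perp_poly n ?G = reflect_poly (frob_poly q g')"
    using xn1_nonzero[OF n, where 'a = 'a] by (metis mult_eq_0_iff nonzero_mult_div_cancel_left perp_poly_def)
  moreover have "reflect_poly (frob_poly q g') dvd Poly u"
  proof (rule orthogonal_imp_reflect_dvd[OF GG' n])
    show "degree (Poly u) < n"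
      by (rule cls_Poly(2)[OF un n])
    fix j assume "j < n - degree ?G"
    \<comment> \<open>For these shifts no reduction modulo x^n - 1 takes place, so entries of the
      codeword are coefficients of the polynomial.\<close>
    then have j: "degree (monom 1 j * g) < n"
      using degree_mult_le[of "monom 1 j" g] degree_monom_le[of "1::'a" j] by (simp add: degree_frob_poly)
    have "cls n (monom 1 j * g) \<in> cyclic_code n g"
      by (rule cls_in_cyclic_code) simp
    then have "herm_inner q u (cls n (monom 1 j * g)) = 0"
      using u by (simp add: herm_dual_iff)
    then have "herm_inner q (cls n (monom 1 j * g)) u = 0"
      using herm_inner_swap[OF un cls_words] by (simp add: power_q_0)
    moreover have "(monom 1 j :: 'a poly) = frob_poly q (monom 1 j)"
      by (rule poly_eqI) (simp add: coeff_frob_poly power_q_0)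
    then have "monom 1 j * ?G = frob_poly q (monom 1 j * g)"
      by (metis frob_poly_mult)
    then have "coeff (Poly u) i * coeff (monom 1 j * ?G) i = cls n (monom 1 j * g) ! i ^ q * u ! i"
      if "i < n" for i
      using that un by (simp add: cls_small[OF j] coeff_frob_poly nth_default_def words_iff)
    ultimately show "(\<Sum>i<n. coeff (Poly u) i * coeff (monom 1 j * ?G) i) = 0"
      by (simp add: herm_inner_def cls_words[unfolded words_iff])
  qed
  ultimately have "g dvd Poly u"
    using perp by (metis dvd_trans)
  then have "cls n (Poly u) \<in> cyclic_code n g"
    by (rule cls_in_cyclic_code)
  then show "u \<in> cyclic_code n g"
    by (simp only: cls_Poly(1)[OF un n])
qed

lemma herm_inner_append:
  assumes "length x = length y"
  shows "herm_inner q (x @ x') (y @ y') = herm_inner q x y + herm_inner q x' (y' :: 'a list)"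
proof -
  have "(\<Sum>i<m + k. F i) = (\<Sum>i<m. F i) + (\<Sum>i<k. F (m + i))" for F :: "nat \<Rightarrow> 'a" and m k
    by (induction k) (simp_all add: add.assoc)
  then show ?thesis
    using assms by (simp add: herm_inner_def nth_append)
qed

lemma herm_dual_qc_code_subset:
  fixes f g h :: "'a poly"
  assumes g: "g dvd xn1 n" "degree g < n" and perp: "g dvd perp_poly n (frob_poly q g)"
    and fg: "f dvd g"
  shows "herm_dual q (2 * n) (qc_code n f g h) \<subseteq> qc_code n f g h"
proof
  fix x assume x: "x \<in> herm_dual q (2 * n) (qc_code n f g h)"
  obtain k where k: "g = k * f"
    using fg by (metis dvdE mult.commute)
  define u v where "u = take n x" and "v = drop n x"
  have xuv: "x = u @ v" and len: "length u = n" "length v = n"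
    using x by (simp_all add: u_def v_def herm_dual_def)
  have cls0: "cls n 0 = wzero n"
    by (auto intro: words_eqI[of _ n] simp: cls_words wzero_words cls_nth)
  have orth: "herm_inner q u y + herm_inner q v z = 0"
    if "y @ z \<in> qc_code n f g h" "length y = n" for y z
    using x that herm_inner_append[of u y v z] len by (auto simp: xuv herm_dual_iff)
  have zero: "herm_inner q w (wzero n) = 0" if "length w = n" for w :: "'a list"
    using that by (simp add: herm_inner_def)
  have "u \<in> herm_dual q n (cyclic_code n g)"
  proof -
    have "herm_inner q u (cls n (a * g)) = 0" for a
    proof -
      \<comment> \<open>The multiplier of ([f], [hf]) is chosen so that the first half is [a g];
        subtracting a h times (0, [g]) clears the second half.\<close>
      have "a * k * (h * f) + - (a * h) * g = 0"
        by (simp add: k)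
      then have "cls n (a * g) @ wzero n \<in> qc_code n f g h"
        using qc_codeI[of n "a * k" f h "- (a * h)" g] by (simp add: k mult.assoc cls0)
      then show ?thesis
        using orth[of "cls n (a * g)" "wzero n"] zero[OF len(2)] cls_words[of n "a * g"]
        by (simp add: words_iff)
    qed
    then show ?thesis
      using len by (auto simp: herm_dual_iff words_iff cyclic_code_def)
  qed
  then have "u \<in> cyclic_code n g"
    using herm_dual_cyclic_code_subset[OF g perp] by blast
  then obtain a where a: "u = cls n (a * g)"
    by (auto simp: cyclic_code_def)
  have "v \<in> herm_dual q n (cyclic_code n g)"
  proof -
    have "herm_inner q v (cls n (b * g)) = 0" for b
    proof -
      have "wzero n @ cls n (b * g) \<in> qc_code n f g h"
        using qc_codeI[of n 0 f h b g] by (simp add: cls0)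
      then show ?thesis
        using orth[of "wzero n" "cls n (b * g)"] zero len by simp
    qed
    then show ?thesis
      using len by (auto simp: herm_dual_iff words_iff cyclic_code_def)
  qed
  then have "v \<in> cyclic_code n g"
    using herm_dual_cyclic_code_subset[OF g perp] by blast
  then obtain b where b: "v = cls n (b * g)"
    by (auto simp: cyclic_code_def)
  \<comment> \<open>The same cancellation, now leaving [b g] in the second half, exhibits ([a g],
    [b g]) as a codeword.\<close>
  have "a * k * (h * f) + (b - a * h) * g = b * g"
    by (simp add: k algebra_simps)
  then show "x \<in> qc_code n f g h"
    using qc_codeI[of n "a * k" f h "b - a * h" g] by (simp add: xuv a b k mult.assoc)
qed

end

subsection \<open>Minimum distance\<close>

lemma hweight_append: "hweight (x @ y) = hweight x + hweight y"
proof -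
  have "hweight z = length (filter (\<lambda>a. a \<noteq> 0) z)" for z :: "'a list"
    by (simp add: hweight_def length_filter_conv_card)
  then show ?thesis
    by simp
qed

lemma min_dist_le:
  assumes "x \<in> C" and "x \<noteq> replicate (length x) 0"
  shows "min_dist C \<le> enat (hweight x)"
  unfolding min_dist_def by (rule Inf_lower) (use assms in blast)

lemma cyc_dist_le:
  assumes "u dvd a" and "cls n a \<noteq> wzero n"
  shows "cyc_dist n u \<le> enat (hweight (cls n a))"
  unfolding cyc_dist_def
  by (rule min_dist_le) (use assms in \<open>simp_all add: cls_in_cyclic_code, simp add: cls_def\<close>)

lemma de_bound_le_hweight:
  fixes f g h :: "'a::field_gcd poly"
  assumes n: "n \<ge> 1" and f: "f dvd xn1 n" and g: "g dvd xn1 n"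
    and x: "x \<in> qc_code n f g h" "x \<noteq> wzero (2 * n)"
  shows "de_bound n f g h \<le> enat (hweight x)"
proof -
  obtain a b where x_eq: "x = cls n (a * f) @ cls n (a * (h * f) + b * g)"
    using x(1) by (auto simp: qc_code_def)
  have le: "de_bound n f g h \<le> cyc_dist n g"
    "de_bound n f g h \<le> cyc_dist n (lcm f (g div gcd g h))"
    "de_bound n f g h \<le> cyc_dist n f + cyc_dist n (gcd (h * f) g)"
    unfolding de_bound_def by (rule Min_le; simp)+
  let ?y = "a * (h * f) + b * g"
  have w: "hweight x = hweight (cls n (a * f)) + hweight (cls n ?y)"
    by (simp add: x_eq hweight_append)
  have nz: "cls n (a * f) \<noteq> wzero n \<or> cls n ?y \<noteq> wzero n"
    using x(2) by (auto simp: x_eq mult_2 replicate_add)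
  consider (first) "cls n (a * f) = wzero n" "cls n ?y \<noteq> wzero n"
    | (second) "cls n (a * f) \<noteq> wzero n" "cls n ?y = wzero n"
    | (both) "cls n (a * f) \<noteq> wzero n" "cls n ?y \<noteq> wzero n"
    using nz by blast
  then show ?thesis
  proof cases
    case first
    have "xn1 n dvd h * (a * f)"
      using first(1) by (simp add: cls_eq_0_iff[OF n])
    then have "g dvd ?y"
      using g by (metis dvd_add dvd_trans dvd_triv_right mult.left_commute)
    then have "cyc_dist n g \<le> enat (hweight x)"
      using cyc_dist_le[OF _ first(2)] w by (metis enat_ord_simps(1) le_add2 order_trans)
    then show ?thesis
      using le by (metis order_trans)
  next
    case second
    have "g dvd ?y"
      using second(2) g by (metis cls_eq_0_iff dvd_trans n)
    then have "g dvd h * (a * f)"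
      by (simp add: dvd_add_left_iff mult.left_commute)
    moreover have "g \<noteq> 0"
      using g xn1_nonzero[OF n] by auto
    \<comment> \<open>After cancelling the gcd, g / gcd(g, h) is coprime to h / gcd(g, h) and must
      divide the remaining factor a f.\<close>
    ultimately have "g div gcd g h dvd h div gcd g h * (a * f)"
      using dvd_mult_cancel_left[of "gcd g h" "g div gcd g h" "h div gcd g h * (a * f)"]
      by (simp flip: mult.assoc)
    then have "g div gcd g h dvd a * f"
      using \<open>g \<noteq> 0\<close> by (metis coprime_dvd_mult_right_iff div_gcd_coprime)
    then have "lcm f (g div gcd g h) dvd a * f"
      by simp
    then have "cyc_dist n (lcm f (g div gcd g h)) \<le> enat (hweight x)"
      using cyc_dist_le[OF _ second(1)] w by (metis enat_ord_simps(1) le_add1 order_trans)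
    then show ?thesis
      using le by (metis order_trans)
  next
    case both
    have "gcd (h * f) g dvd ?y"
      by (meson dvd_add dvd_mult gcd_dvd1 gcd_dvd2)
    then have "cyc_dist n f + cyc_dist n (gcd (h * f) g)
        \<le> enat (hweight (cls n (a * f))) + enat (hweight (cls n ?y))"
      by (intro add_mono cyc_dist_le both) simp_all
    then have "cyc_dist n f + cyc_dist n (gcd (h * f) g) \<le> enat (hweight x)"
      by (simp add: w)
    then show ?thesis
      using le by (metis order_trans)
  qed
qed

section \<open>Operators\<close>

lemma op_mult_assoc: "op_mult I (op_mult I A B) C = op_mult I A (op_mult I B C)"
proof (intro ext)
  fix u w
  have "op_mult I (op_mult I A B) C u w = (\<Sum>v\<in>I. \<Sum>t\<in>I. A u t * B t v * C v w)"
    by (simp add: op_mult_def sum_distrib_right)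
  also have "\<dots> = (\<Sum>t\<in>I. \<Sum>v\<in>I. A u t * B t v * C v w)"
    by (rule sum.swap)
  also have "\<dots> = op_mult I A (op_mult I B C) u w"
    by (simp add: op_mult_def sum_distrib_left mult.assoc)
  finally show "op_mult I (op_mult I A B) C u w = op_mult I A (op_mult I B C) u w" .
qed

lemma op_apply_op_mult: "op_apply I (op_mult I A B) \<psi> = op_apply I A (op_apply I B \<psi>)"
proof
  fix u
  have "op_apply I (op_mult I A B) \<psi> u = (\<Sum>v\<in>I. \<Sum>t\<in>I. A u t * B t v * \<psi> v)"
    by (simp add: op_apply_def op_mult_def sum_distrib_right)
  also have "\<dots> = (\<Sum>t\<in>I. \<Sum>v\<in>I. A u t * B t v * \<psi> v)"
    by (rule sum.swap)
  also have "\<dots> = op_apply I A (op_apply I B \<psi>) u"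
    by (simp add: op_apply_def sum_distrib_left mult.assoc)
  finally show "op_apply I (op_mult I A B) \<psi> u = op_apply I A (op_apply I B \<psi>) u" .
qed

lemma op_mult_scale [simp]:
  "op_mult I (op_scale c A) B = op_scale c (op_mult I A B)"
  "op_mult I A (op_scale c B) = op_scale c (op_mult I A B)"
  by (auto simp: op_mult_def op_scale_def sum_distrib_left mult_ac)

lemma op_scale_scale [simp]: "op_scale c (op_scale d A) = op_scale (c * d) A"
  by (simp add: op_scale_def mult_ac)

lemma op_scale_1 [simp]: "op_scale 1 A = A"
  by (simp add: op_scale_def)

lemma op_apply_scale: "op_apply I (op_scale c A) \<psi> = ket_scale c (op_apply I A \<psi>)"
  by (simp add: op_apply_def op_scale_def ket_scale_def sum_distrib_left mult_ac)

lemma op_apply_ket_scale: "op_apply I A (ket_scale c \<psi>) = ket_scale c (op_apply I A \<psi>)"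
  by (simp add: op_apply_def ket_scale_def sum_distrib_left mult_ac)

lemma op_apply_sum: "op_apply I A (\<lambda>u. \<Sum>k\<in>K. f k u) = (\<lambda>u. \<Sum>k\<in>K. op_apply I A (f k) u)"
proof
  fix u
  have "op_apply I A (\<lambda>u. \<Sum>k\<in>K. f k u) u = (\<Sum>v\<in>I. \<Sum>k\<in>K. A u v * f k v)"
    by (simp add: op_apply_def sum_distrib_left)
  also have "\<dots> = (\<Sum>k\<in>K. op_apply I A (f k) u)"
    unfolding op_apply_def by (rule sum.swap)
  finally show "op_apply I A (\<lambda>u. \<Sum>k\<in>K. f k u) u = (\<Sum>k\<in>K. op_apply I A (f k) u)" .
qed

lemma ket_scale_scale: "ket_scale c (ket_scale d \<psi>) = ket_scale (c * d) \<psi>"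
  by (simp add: ket_scale_def mult_ac)

lemma ket_scale_1: "ket_scale 1 \<psi> = \<psi>"
  by (simp add: ket_scale_def)

lemma ket_scale_cancel:
  assumes "ket_scale c \<psi> = ket_scale d \<psi>" and "\<psi> \<noteq> (\<lambda>u. 0)"
  shows "c = d"
proof -
  obtain u where "\<psi> u \<noteq> 0"
    using assms(2) by auto
  then show ?thesis
    using fun_cong[OF assms(1), of u] by (simp add: ket_scale_def)
qed

lemma op_apply_in_kets: "A \<in> opers I \<Longrightarrow> op_apply I A \<psi> \<in> kets I"
  by (simp add: kets_def opers_def op_apply_def)

lemma op_scale_in_opers: "A \<in> opers I \<Longrightarrow> op_scale c A \<in> opers I"
  by (simp add: opers_def op_scale_def)

lemma op_adj_in_opers: "A \<in> opers I \<Longrightarrow> op_adj A \<in> opers I"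
  by (auto simp: opers_def op_adj_def)

lemma op_mult_id:
  assumes "finite I" and "A \<in> opers I"
  shows "op_mult I (op_id I) A = A" and "op_mult I A (op_id I) = A"
proof -
  have "(\<Sum>v\<in>I. (if u \<in> I \<and> u = v then 1 else 0) * A v w) = A u w" for u w
  proof -
    have "(\<Sum>v\<in>I. (if u \<in> I \<and> u = v then 1 else 0) * A v w) = (\<Sum>v\<in>I. if u = v then A v w else 0)"
      by (rule sum.cong) auto
    then show ?thesis
      using assms by (auto simp: opers_def)
  qed
  then show "op_mult I (op_id I) A = A"
    by (simp add: op_mult_def op_id_def)
  have "(\<Sum>v\<in>I. A u v * (if v \<in> I \<and> v = w then 1 else 0)) = A u w" for u w
  proof -
    have "(\<Sum>v\<in>I. A u v * (if v \<in> I \<and> v = w then 1 else 0)) = (\<Sum>v\<in>I. if v = w then A u v else 0)"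
      by (rule sum.cong) auto
    then show ?thesis
      using assms by (auto simp: opers_def)
  qed
  then show "op_mult I A (op_id I) = A"
    by (simp add: op_mult_def op_id_def)
qed

lemma op_apply_id:
  assumes "finite I" and "\<psi> \<in> kets I"
  shows "op_apply I (op_id I) \<psi> = \<psi>"
proof
  fix u
  have "op_apply I (op_id I) \<psi> u = (\<Sum>v\<in>I. if u = v then \<psi> v else 0)"
    unfolding op_apply_def op_id_def by (rule sum.cong) auto
  then show "op_apply I (op_id I) \<psi> u = \<psi> u"
    using assms by (auto simp: kets_def)
qed

lemma op_adj_scale: "op_adj (op_scale c A) = op_scale (cnj c) (op_adj A)"
  by (simp add: op_adj_def op_scale_def)

text \<open>
  An eigenvector is one of the discrete Fourier components of the orbit of \<open>\<psi>\<close>: they add up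
  to \<open>M \<psi>\<close>, so they do not all vanish.
\<close>

lemma eigenvector_in_orbit:
  assumes M: "M > 0" and per: "(op_apply I A ^^ M) \<psi> = \<psi>" and nz: "\<psi> \<noteq> (\<lambda>u. 0)"
  obtains c z where "(\<lambda>u. \<Sum>k<M. c k * (op_apply I A ^^ k) \<psi> u) \<noteq> (\<lambda>u. 0)"
    and "op_apply I A (\<lambda>u. \<Sum>k<M. c k * (op_apply I A ^^ k) \<psi> u)
      = ket_scale z (\<lambda>u. \<Sum>k<M. c k * (op_apply I A ^^ k) \<psi> u)"
proof -
  let ?F = "\<lambda>k. (op_apply I A ^^ k) \<psi>"
  define \<eta> where "\<eta> = inverse (omega M)"
  have omega0: "omega M \<noteq> 0"
    using norm_omega[of M] by auto
  have \<eta>M: "\<eta> ^ M = 1"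
    using omega_power_eq_iff[OF M, of M 0] by (simp add: \<eta>_def power_inverse)
  have \<eta>k: "\<eta> ^ k \<noteq> 1" if "0 < k" "k < M" for k
    using omega_power_eq_iff[OF M, of k 0] that by (simp add: \<eta>_def power_inverse)
  define \<phi> where "\<phi> j = (\<lambda>u. \<Sum>k<M. (\<eta> ^ j) ^ k * ?F k u)" for j
  have "(\<Sum>j<M. \<phi> j u) = of_nat M * \<psi> u" for u
  proof -
    have "(\<Sum>j<M. (\<eta> ^ j) ^ k) = (if k = 0 then of_nat M else 0)" if "k < M" for k
    proof (cases "k = 0")
      case False
      have "(\<eta> ^ k - 1) * (\<Sum>j<M. (\<eta> ^ k) ^ j) = (\<eta> ^ k) ^ M - 1"
        by (rule power_diff_1_eq[symmetric])
      also have "\<dots> = 0"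
        using \<eta>M by (simp add: mult.commute flip: power_mult) (simp add: power_mult)
      finally show ?thesis
        using \<eta>k[of k] that False by (simp add: mult.commute flip: power_mult)
    qed simp
    then have "(\<Sum>k<M. (\<Sum>j<M. (\<eta> ^ j) ^ k) * ?F k u)
        = (\<Sum>k<M. if k = 0 then of_nat M * \<psi> u else 0)"
      by (intro sum.cong) auto
    also have "\<dots> = of_nat M * \<psi> u"
      using M by simp
    finally show ?thesis
      unfolding \<phi>_def by (subst sum.swap) (simp add: sum_distrib_right)
  qed
  moreover obtain u where "\<psi> u \<noteq> 0"
    using nz by auto
  ultimately have "(\<Sum>j<M. \<phi> j u) \<noteq> 0"
    using M by simp
  then obtain j where j: "\<phi> j u \<noteq> 0"
    by (meson sum.neutral)
  define w where "w = \<eta> ^ j"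
  have w0: "w \<noteq> 0"
    using omega0 by (simp add: w_def \<eta>_def)
  have wM: "w ^ M = 1"
    using \<eta>M by (simp add: w_def mult.commute flip: power_mult) (simp add: power_mult)
  have \<phi>j: "\<phi> j = (\<lambda>u. \<Sum>k<M. w ^ k * ?F k u)"
    by (simp add: \<phi>_def w_def)
  have eig: "op_apply I A (\<phi> j) = ket_scale (inverse w) (\<phi> j)"
  proof
    fix v
    have "op_apply I A (\<phi> j) v = (\<Sum>k<M. w ^ k * ?F (Suc k) v)"
    proof -
      have "op_apply I A (\<lambda>u. w ^ k * ?F k u) = (\<lambda>u. w ^ k * ?F (Suc k) u)" for k
        using op_apply_ket_scale[of I A "w ^ k" "?F k"] by (simp add: ket_scale_def)
      then show ?thesis
        unfolding \<phi>j op_apply_sum by simp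
    qed
    also have "w * \<dots> = (\<Sum>k<M. w ^ Suc k * ?F (Suc k) v)"
      by (simp add: sum_distrib_left mult.assoc)
    \<comment> \<open>Shifting the index replaces the term for \<open>k = 0\<close> by the one for
      \<open>k = M\<close>; they coincide because \<open>w ^ M = 1\<close> and the orbit has period
      \<open>M\<close>.\<close>
    also have "w ^ 0 * ?F 0 v + \<dots> = (\<Sum>k<Suc M. w ^ k * ?F k v)"
      by (rule sum.lessThan_Suc_shift[symmetric])
    also have "\<dots> = \<phi> j v + \<psi> v"
      by (simp add: \<phi>j wM per)
    finally have "w * op_apply I A (\<phi> j) v = \<phi> j v"
      by simp
    then show "op_apply I A (\<phi> j) v = ket_scale (inverse w) (\<phi> j) v"
      using w0 by (simp add: ket_scale_def field_simps)
  qed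
  have "\<phi> j \<noteq> (\<lambda>u. 0)"
    using j by auto
  from this eig show thesis
    unfolding \<phi>j by (rule that)
qed

text \<open>Induction on the set. For a common eigenvector \<psi> of \<open>X\<close>, every
  combination of the vectors A^k \<psi> keeps the eigenvalues of \<psi> under the operators in
  \<open>X\<close>, since these commute with \<open>A\<close>. One such combination is an
  eigenvector of \<open>A\<close>.\<close>

lemma common_eigenvector:
  assumes "finite X" and "finite I" and "I \<noteq> {}"
    and "\<And>A. A \<in> X \<Longrightarrow> A \<in> opers I"
    and "\<And>A. A \<in> X \<Longrightarrow> \<exists>M>0. \<forall>\<psi>\<in>kets I. (op_apply I A ^^ M) \<psi> = \<psi>"
    and "\<And>A B. A \<in> X \<Longrightarrow> B \<in> X \<Longrightarrow> op_mult I A B = op_mult I B A"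
  shows "\<exists>\<psi>\<in>kets I. \<psi> \<noteq> (\<lambda>u. 0) \<and> (\<forall>A\<in>X. \<exists>z. op_apply I A \<psi> = ket_scale z \<psi>)"
  using assms
proof (induction X rule: finite_induct)
  case empty
  then obtain i where "i \<in> I"
    by blast
  then have "(\<lambda>u. if u = i then 1 else 0) \<in> kets I"
    by (auto simp: kets_def)
  moreover have "(\<lambda>u. if u = i then 1 else 0) \<noteq> (\<lambda>u. 0 :: complex)"
    by (metis zero_neq_one)
  ultimately show ?case
    by blast
next
  case (insert A X)
  have "\<exists>\<psi>\<in>kets I. \<psi> \<noteq> (\<lambda>u. 0) \<and> (\<forall>B\<in>X. \<exists>z. op_apply I B \<psi> = ket_scale z \<psi>)"
    by (rule insert.IH) (use insert.prems in auto)
  then obtain \<psi> where \<psi>: "\<psi> \<in> kets I" "\<psi> \<noteq> (\<lambda>u. 0)" "\<forall>B\<in>X. \<exists>z. op_apply I B \<psi> = ket_scale z \<psi>"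
    by blast
  obtain M where M: "M > 0" "\<forall>\<psi>\<in>kets I. (op_apply I A ^^ M) \<psi> = \<psi>"
    using insert.prems(4)[of A] by auto
  let ?F = "\<lambda>k. (op_apply I A ^^ k) \<psi>"
  obtain c z where cz: "(\<lambda>u. \<Sum>k<M. c k * ?F k u) \<noteq> (\<lambda>u. 0)"
    "op_apply I A (\<lambda>u. \<Sum>k<M. c k * ?F k u) = ket_scale z (\<lambda>u. \<Sum>k<M. c k * ?F k u)"
    using eigenvector_in_orbit[OF M(1) bspec[OF M(2) \<psi>(1)] \<psi>(2)] by blast
  let ?\<phi> = "\<lambda>u. \<Sum>k<M. c k * ?F k u"
  have Fk: "?F k \<in> kets I" for k
    using \<psi>(1) op_apply_in_kets[of A I] insert.prems(3)[of A] by (cases k) auto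
  have "?\<phi> \<in> kets I"
    using Fk by (simp add: kets_def)
  moreover have "\<exists>z. op_apply I B ?\<phi> = ket_scale z ?\<phi>" if B: "B \<in> X" for B
  proof -
    obtain \<beta> where \<beta>: "op_apply I B \<psi> = ket_scale \<beta> \<psi>"
      using \<psi>(3) B by blast
    have BF: "op_apply I B (?F k) = ket_scale \<beta> (?F k)" for k
    proof (induction k)
      case (Suc k)
      have "op_apply I B (?F (Suc k)) = op_apply I (op_mult I B A) (?F k)"
        by (simp add: op_apply_op_mult)
      also have "\<dots> = op_apply I A (op_apply I B (?F k))"
        using insert.prems(5)[of B A] B by (simp add: op_apply_op_mult)
      finally show ?case
        by (simp add: Suc.IH op_apply_ket_scale)
    qed (simp add: \<beta>)
    have "op_apply I B (\<lambda>u. c k * ?F k u) = (\<lambda>u. \<beta> * (c k * ?F k u))" for k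
      using op_apply_ket_scale[of I B "c k" "?F k"] by (simp add: ket_scale_def BF mult_ac)
    then have "op_apply I B ?\<phi> = ket_scale \<beta> ?\<phi>"
      unfolding op_apply_sum by (simp add: ket_scale_def sum_distrib_left)
    then show ?thesis
      by blast
  qed
  ultimately show ?case
    using cz by blast
qed

text \<open>Expand the columns of \<open>P\<close> in a basis \<open>B\<close> of the range. Because
  \<open>P\<close> fixes the range, the coordinate vectors are dual to \<open>B\<close>, so the
  trace counts the elements of \<open>B\<close>.\<close>

lemma ket_dim_eq_trace:
  assumes I: "finite I" and P: "P \<in> opers I" "op_mult I P P = P"
  shows "of_nat (ket.dim (op_apply I P ` kets I)) = (\<Sum>u\<in>I. P u u)"
proof -
  let ?C = "op_apply I P ` kets I"
  obtain B where B: "B \<subseteq> ?C" "ket.independent B" "?C \<subseteq> ket.span B" "card B = ket.dim ?C"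
    using ket.basis_exists by blast
  have fix_P: "op_apply I P \<psi> = \<psi>" if "\<psi> \<in> ?C" for \<psi>
    using that P(2) by (auto simp flip: op_apply_op_mult)
  define e where "e i = (\<lambda>u. if u = i then 1 else 0 :: complex)" for i :: 'a
  have sum_fun: "(\<Sum>x\<in>X. g x) u = (\<Sum>x\<in>X. g x u)" for X and g :: "'c \<Rightarrow> 'a \<Rightarrow> complex" and u
    by (induction X rule: infinite_finite_induct) (simp_all add: zero_fun_def plus_fun_def)
  have "kets I \<subseteq> ket.span (e ` I)"
  proof
    fix \<psi> assume \<psi>: "\<psi> \<in> kets I"
    have "\<psi> = (\<Sum>i\<in>I. ket_scale (\<psi> i) (e i))"
    proof
      fix u
      have "(\<Sum>i\<in>I. ket_scale (\<psi> i) (e i)) u = (\<Sum>i\<in>I. if u = i then \<psi> i else 0)"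
        unfolding sum_fun by (rule sum.cong) (auto simp: ket_scale_def e_def)
      then show "\<psi> u = (\<Sum>i\<in>I. ket_scale (\<psi> i) (e i)) u"
        using \<psi> I by (auto simp: kets_def)
    qed
    also have "\<dots> \<in> ket.span (e ` I)"
      by (intro ket.span_sum ket.span_scale ket.span_base) simp
    finally show "\<psi> \<in> ket.span (e ` I)" .
  qed
  moreover have "?C \<subseteq> kets I"
    using op_apply_in_kets[OF P(1)] by blast
  ultimately have fin: "finite B"
    using ket.independent_span_bound[of "e ` I" B] I B by blast
  define c where "c w = ket.representation B (\<lambda>u. P u w)" for w
  have col: "(\<lambda>u. P u w) \<in> ?C" if w: "w \<in> I" for w
  proof (rule image_eqI)
    show "e w \<in> kets I"
      using w by (auto simp: kets_def e_def)
    show "(\<lambda>u. P u w) = op_apply I P (e w)"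
    proof
      fix u
      have "op_apply I P (e w) u = (\<Sum>v\<in>I. if v = w then P u v else 0)"
        unfolding op_apply_def e_def by (rule sum.cong) auto
      then show "P u w = op_apply I P (e w) u"
        using I w by simp
    qed
  qed
  have Puw: "P u w = (\<Sum>b\<in>B. c w b * b u)" if w: "w \<in> I" for u w
  proof -
    have "(\<Sum>b\<in>B. ket_scale (c w b) b) = (\<lambda>u. P u w)"
      unfolding c_def
      by (rule ket.sum_representation_eq) (use B col[OF w] fin in auto)
    from fun_cong[OF this, of u] show ?thesis
      unfolding sum_fun by (simp add: ket_scale_def)
  qed
  \<comment> \<open>Both sides of \<open>P b' = b'\<close> are written in the basis
    \<open>B\<close>, and independence allows comparing coefficients.\<close>
  have dual: "(\<Sum>w\<in>I. c w b * b' w) = (if b = b' then 1 else 0)" if b: "b \<in> B" "b' \<in> B" for b b'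
  proof -
    let ?x = "\<lambda>b. (\<Sum>w\<in>I. c w b * b' w) - (if b = b' then 1 else 0)"
    have "(\<Sum>b\<in>B. ket_scale (?x b) b) = 0"
    proof
      fix u
      have "b' u = op_apply I P b' u"
        by (subst fix_P) (use B(1) b(2) in auto)
      also have "\<dots> = (\<Sum>w\<in>I. \<Sum>b\<in>B. c w b * b u * b' w)"
        by (simp add: op_apply_def Puw sum_distrib_right)
      also have "\<dots> = (\<Sum>b\<in>B. (\<Sum>w\<in>I. c w b * b' w) * b u)"
        by (subst sum.swap) (simp add: sum_distrib_left mult_ac)
      finally have "b' u = (\<Sum>b\<in>B. (\<Sum>w\<in>I. c w b * b' w) * b u)" .
      moreover have "(\<Sum>b\<in>B. (if b = b' then 1 else 0) * b u) = (\<Sum>b\<in>B. if b = b' then b u else 0)"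
        by (rule sum.cong) auto
      then have "(\<Sum>b\<in>B. (if b = b' then 1 else 0) * b u) = b' u"
        using b(2) fin by simp
      ultimately show "(\<Sum>b\<in>B. ket_scale (?x b) b) u = 0 u"
        unfolding sum_fun by (simp add: ket_scale_def left_diff_distrib sum_subtractf)
    qed
    then have "?x b = 0"
      using ket.independentD[OF B(2) fin subset_refl, where u = ?x] b(1) by simp
    then show ?thesis
      by simp
  qed
  have "(\<Sum>u\<in>I. P u u) = (\<Sum>u\<in>I. \<Sum>b\<in>B. c u b * b u)"
    by (simp add: Puw)
  also have "\<dots> = (\<Sum>b\<in>B. \<Sum>u\<in>I. c u b * b u)"
    by (rule sum.swap)
  also have "\<dots> = of_nat (card B)"
    by (simp add: dual)
  finally show ?thesis
    by (simp add: B(4))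
qed

section \<open>The error group and stabilizer codes\<close>

lemma wadd_assoc:
  fixes x y z :: "'a::semigroup_add list"
  assumes "x \<in> words N" "y \<in> words N" "z \<in> words N"
  shows "wadd (wadd x y) z = wadd x (wadd y z)"
  by (rule words_eqI[of _ N]) (simp_all add: assms wadd_words wadd_nth[of _ N] add.assoc)

lemma wadd_wzero:
  fixes x :: "'a::monoid_add list"
  assumes "x \<in> words N"
  shows "wadd x (wzero N) = x" and "wadd (wzero N) x = x"
  by (auto intro!: words_eqI[of _ N] simp: assms wadd_words wzero_words wadd_nth[of _ N])

lemma wadd_wminus:
  fixes x :: "'a::ring_1 list"
  assumes "x \<in> words N"
  shows "wadd x (wscale (- 1) x) = wzero N"
  by (rule words_eqI[of _ N])
    (simp_all add: assms wadd_words wscale_words wzero_words wadd_nth[of _ N] wscale_nth[of _ N])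

lemma wadd_right_cancel:
  fixes x y z :: "'a::cancel_semigroup_add list"
  assumes "x \<in> words N" "y \<in> words N" "z \<in> words N"
  shows "wadd x z = wadd y z \<longleftrightarrow> x = y"
proof
  assume eq: "wadd x z = wadd y z"
  show "x = y"
  proof (rule words_eqI[OF assms(1,2)])
    fix i assume "i < N"
    then show "x ! i = y ! i"
      using arg_cong[OF eq, of "\<lambda>w. w ! i"] assms by (simp add: wadd_nth[of _ N])
  qed
qed simp

lemma wdot_wadd:
  assumes "x \<in> words N" "y \<in> words N" "z \<in> words N"
  shows "wdot (wadd x y) z = wdot x z + wdot y z" and "wdot x (wadd y z) = wdot x y + wdot x z"
proof -
  have "length x = N" "length y = N" "length (wadd x y) = N"
    using assms wadd_words[of x N y] by (simp_all add: words_iff)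
  then show "wdot (wadd x y) z = wdot x z + wdot y z"
    and "wdot x (wadd y z) = wdot x y + wdot x z"
    by (simp_all add: wdot_def assms wadd_nth[of _ N] algebra_simps sum.distrib)
qed

lemma wdot_wzero: "wdot (wzero N) x = 0" and wdot_wzero_right: "x \<in> words N \<Longrightarrow> wdot x (wzero N) = 0"
  by (simp_all add: wdot_def words_iff)

section \<open>Error operators labelled by pairs of words\<close>

text \<open>Closed form of the tensor product of the X(a_i) Z(b_i) for \<open>x = (a, b)\<close>:
  the basis vector at \<open>v\<close> goes to \<chi>(b.v) times the one at \<open>v + a\<close>.
  Products can then be computed without tensors.\<close>

definition err :: "nat \<Rightarrow> nat \<Rightarrow> nat \<Rightarrow> 'b::field list \<times> 'b list \<Rightarrow> 'b list oper"
  where "err p r N x = (\<lambda>u v. if v \<in> words N \<and> u = wadd v (fst x)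
    then add_char p r (wdot (snd x) v) else 0)"

definition padd :: "'b::plus list \<times> 'b list \<Rightarrow> 'b list \<times> 'b list \<Rightarrow> 'b list \<times> 'b list"
  where "padd x y = (wadd (fst x) (fst y), wadd (snd x) (snd y))"

definition pneg :: "'b::ring_1 list \<times> 'b list \<Rightarrow> 'b list \<times> 'b list"
  where "pneg x = (wscale (- 1) (fst x), wscale (- 1) (snd x))"

abbreviation pwords :: "nat \<Rightarrow> ('b list \<times> 'b list) set"
  where "pwords N \<equiv> words N \<times> words N"

abbreviation pzero :: "nat \<Rightarrow> 'b::zero list \<times> 'b list"
  where "pzero N \<equiv> (wzero N, wzero N)"

lemma padd_pwords: "x \<in> pwords N \<Longrightarrow> y \<in> pwords N \<Longrightarrow> padd x y \<in> pwords N"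
  by (auto simp: padd_def wadd_words)

lemma padd_comm:
  fixes x y :: "'b::ring_1 list \<times> 'b list"
  shows "x \<in> pwords N \<Longrightarrow> y \<in> pwords N \<Longrightarrow> padd x y = padd y x"
  by (auto simp: padd_def wadd_comm[of _ N])

lemma padd_pneg:
  fixes x :: "'b::ring_1 list \<times> 'b list"
  shows "x \<in> pwords N \<Longrightarrow> padd x (pneg x) = pzero N"
  by (auto simp: padd_def pneg_def wadd_wminus)

lemma padd_pneg_cancel:
  fixes x y :: "'b::ring_1 list \<times> 'b list"
  assumes "x \<in> pwords N" "y \<in> pwords N"
  shows "padd (pneg x) (padd x y) = y" and "padd x (padd (pneg x) y) = y"
  using assms by (auto simp: padd_def pneg_def wadd_cancel[of _ N])

context field_card_prime_power
begin

abbreviation E :: "nat \<Rightarrow> 'b list \<times> 'b list \<Rightarrow> 'b list oper"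
  where "E \<equiv> err p r"

text \<open>The phase from moving the Z-part of \<open>x\<close> past the X-part of
  \<open>y\<close>. Two errors commute exactly when it is symmetric in their labels, and the
  quotient of its two values is the character of the symplectic form.\<close>

definition cocycle :: "'b list \<times> 'b list \<Rightarrow> 'b list \<times> 'b list \<Rightarrow> complex"
  where "cocycle x y = chi (wdot (snd x) (fst y))"

lemma XZ_entry:
  "op_mult UNIV (X_op a) (Z_op p r b) u v = (if u = v + a then chi (b * v) else 0)" for a b u v :: 'b
proof -
  have "op_mult UNIV (X_op a) (Z_op p r b) u v
      = (\<Sum>w\<in>UNIV. if w = v then (if u = v + a then chi (b * v) else 0) else 0)"
    unfolding op_mult_def X_op_def Z_op_def by (rule sum.cong) (auto simp: add_char_def)
  then show ?thesis
    by simp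
qed

lemma error_op_eq:
  assumes "a \<in> words N" and "b \<in> words N"
  shows "error_op p r N c a b = op_scale (omega p ^ c) (E N (a, b))"
proof -
  have "tensor N (\<lambda>i. op_mult UNIV (X_op (a ! i)) (Z_op p r (b ! i))) u v = E N (a, b) u v" for u v
  proof (cases "u \<in> words N \<and> v \<in> words N")
    case True
    have "(\<Prod>i<N. if u ! i = v ! i + a ! i then chi (b ! i * v ! i) else 0)
        = (if u = wadd v a then chi (wdot b v) else 0)"
    proof (cases "u = wadd v a")
      case eq: True
      have "(\<Prod>i<N. if u ! i = v ! i + a ! i then chi (b ! i * v ! i) else 0)
          = (\<Prod>i<N. chi (b ! i * v ! i))"
        by (rule prod.cong) (use True assms in \<open>auto simp: eq wadd_nth[of _ N]\<close>)
      then show ?thesis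
        using eq assms by (simp add: wdot_def chi_sum words_iff)
    next
      case False
      then obtain i where i: "i < N" "u ! i \<noteq> v ! i + a ! i"
        using words_eqI[of u N "wadd v a"] True assms by (auto simp: wadd_words wadd_nth[of _ N])
      then have "(\<Prod>i<N. if u ! i = v ! i + a ! i then chi (b ! i * v ! i) else 0) = 0"
        by (intro prod_zero) auto
      then show ?thesis
        using False by simp
    qed
    then show ?thesis
      using True by (simp add: tensor_def XZ_entry err_def)
  qed (use assms in \<open>auto simp: tensor_def err_def wadd_words\<close>)
  then show ?thesis
    by (simp add: error_op_def op_scale_def)
qed

lemma E_in_opers: "x \<in> pwords N \<Longrightarrow> E N x \<in> opers (words N)"
  by (auto simp: opers_def err_def wadd_words)

lemma E_zero: "E N (pzero N) = op_id (words N)"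
  by (auto simp: err_def op_id_def fun_eq_iff wdot_wzero wadd_wzero)

lemma E_mult:
  assumes "x \<in> pwords N" and "y \<in> pwords N"
  shows "op_mult (words N) (E N x) (E N y) = op_scale (cocycle x y) (E N (padd x y))"
proof (intro ext)
  fix u w
  obtain a b a' b' where xy: "x = (a, b)" "y = (a', b')"
    by (cases x, cases y)
  with assms have W: "a \<in> words N" "b \<in> words N" "a' \<in> words N" "b' \<in> words N"
    by auto
  have "op_mult (words N) (E N x) (E N y) u w
      = (\<Sum>v\<in>words N. if v = wadd w a' then
          (if w \<in> words N \<and> u = wadd (wadd w a') a then chi (wdot b (wadd w a')) * chi (wdot b' w) else 0)
         else 0)"
    unfolding op_mult_def err_def xy by (rule sum.cong) auto
  also have "\<dots> = (if w \<in> words N \<and> u = wadd (wadd w a') a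
      then chi (wdot b (wadd w a')) * chi (wdot b' w) else 0)"
    using W by (simp add: finite_words wadd_words)
  also have "\<dots> = op_scale (cocycle x y) (E N (padd x y)) u w"
  proof (cases "w \<in> words N")
    case True
    have "wadd (wadd w a') a = wadd w (wadd a a')"
      using True W by (simp add: wadd_assoc[of _ N] wadd_comm[of a N a'])
    moreover have "chi (wdot b (wadd w a')) * chi (wdot b' w)
        = chi (wdot b a') * chi (wdot (wadd b b') w)"
      using True W by (simp add: wdot_wadd[of _ N] chi_add)
    ultimately show ?thesis
      using True by (simp add: op_scale_def err_def padd_def cocycle_def xy)
  qed (simp add: op_scale_def err_def)
  finally show "op_mult (words N) (E N x) (E N y) u w = op_scale (cocycle x y) (E N (padd x y)) u w" .
qed

lemma E_unitary:
  assumes "x \<in> pwords N"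
  shows "op_mult (words N) (op_adj (E N x)) (E N x) = op_id (words N)"
proof (intro ext)
  fix u w
  obtain a b where x: "x = (a, b)"
    by (cases x)
  with assms have W: "a \<in> words N" "b \<in> words N"
    by auto
  have "op_mult (words N) (op_adj (E N x)) (E N x) u w
      = (\<Sum>v\<in>words N. if v = wadd w a then (if u \<in> words N \<and> w \<in> words N \<and> wadd w a = wadd u a
          then cnj (chi (wdot b u)) * chi (wdot b w) else 0) else 0)"
    unfolding op_mult_def op_adj_def err_def x by (rule sum.cong) auto
  also have "\<dots> = (if u \<in> words N \<and> w \<in> words N \<and> wadd w a = wadd u a
          then cnj (chi (wdot b u)) * chi (wdot b w) else 0)"
    using W by (simp add: finite_words wadd_words)
  also have "\<dots> = op_id (words N) u w"
    using W complex_norm_square[of "chi (wdot b u)"]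
    by (auto simp: op_id_def wadd_right_cancel[of _ N] norm_add_char mult.commute)
  finally show "op_mult (words N) (op_adj (E N x)) (E N x) u w = op_id (words N) u w" .
qed

text \<open>The \<open>p\<close>-th power of an error is a scalar, because \<open>p\<close> times
  its label is zero. The scalar is a value of \<open>chi\<close>, hence a \<open>p\<close>-th root
  of unity, but it may differ from 1: XZ on one qubit squares to -1. This explains the period
  \<open>p * p\<close>.\<close>

lemma E_periodic:
  assumes x: "x \<in> pwords N"
  shows "\<forall>\<psi>\<in>kets (words N). (op_apply (words N) (E N x) ^^ (p * p)) \<psi> = \<psi>"
proof
  fix \<psi> :: "'b list ket" assume \<psi>: "\<psi> \<in> kets (words N)"
  let ?F = "op_apply (words N) (E N x)"
  obtain a b where ab: "x = (a, b)" "a \<in> words N" "b \<in> words N"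
    using x by auto
  let ?k = "\<lambda>k. (wscale (of_nat k) a, wscale (of_nat k) b)"
  have "\<exists>s. \<forall>\<psi>\<in>kets (words N). (?F ^^ k) \<psi> = ket_scale (chi s) (op_apply (words N) (E N (?k k)) \<psi>)" for k
  proof (induction k)
    case 0
    have "wscale 0 y = wzero N" if "y \<in> words N" for y :: "'b list"
      using that by (auto intro!: words_eqI[of _ N] simp: wscale_words wzero_words wscale_nth[of _ N])
    then have "E N (?k 0) = op_id (words N)"
      using ab by (simp add: E_zero)
    then show ?case
      by (intro exI[of _ 0]) (simp add: op_apply_id finite_words ket_scale_1)
  next
    case (Suc k)
    then obtain s where s: "\<forall>\<psi>\<in>kets (words N). (?F ^^ k) \<psi>
        = ket_scale (chi s) (op_apply (words N) (E N (?k k)) \<psi>)"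
      by blast
    have pk: "padd x (?k k) = ?k (Suc k)"
      using ab by (auto simp: padd_def intro!: words_eqI[of _ N]
          simp: wscale_words wadd_words wadd_nth[of _ N] wscale_nth[of _ N] algebra_simps)
    have kk: "?k k \<in> pwords N"
      using ab by (simp add: wscale_words)
    have "(?F ^^ Suc k) \<phi> = ket_scale (chi (s + wdot b (fst (?k k)))) (op_apply (words N) (E N (?k (Suc k))) \<phi>)"
      if "\<phi> \<in> kets (words N)" for \<phi>
    proof -
      have "(?F ^^ Suc k) \<phi> = ket_scale (chi s) (?F (op_apply (words N) (E N (?k k)) \<phi>))"
        using s that by (simp add: op_apply_ket_scale)
      also have "\<dots> = ket_scale (chi s) (op_apply (words N) (op_mult (words N) (E N x) (E N (?k k))) \<phi>)"
        by (simp only: op_apply_op_mult)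
      also have "\<dots> = ket_scale (chi (s + wdot b (fst (?k k)))) (op_apply (words N) (E N (?k (Suc k))) \<phi>)"
        unfolding E_mult[OF x kk] op_apply_scale pk
        by (simp add: ket_scale_scale cocycle_def ab(1) chi_add)
      finally show ?thesis .
    qed
    then show ?case
      by blast
  qed
  from this[of p] obtain s where s: "\<forall>\<psi>\<in>kets (words N). (?F ^^ p) \<psi>
      = ket_scale (chi s) (op_apply (words N) (E N (?k p)) \<psi>)"
    by blast
  have "of_nat p = (0 :: 'b)"
    by (simp flip: CHAR_eq)
  then have "?k p = pzero N"
    using ab by (auto intro!: words_eqI[of _ N] simp: wscale_words wzero_words wscale_nth[of _ N])
  then have Fp: "(?F ^^ p) \<phi> = ket_scale (chi s) \<phi>" if "\<phi> \<in> kets (words N)" for \<phi>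
    using s that by (simp add: E_zero op_apply_id finite_words)
  have sc: "ket_scale c \<psi> \<in> kets (words N)" for c
    using \<psi> by (simp add: kets_def ket_scale_def)
  have "((?F ^^ p) ^^ m) \<psi> = ket_scale (chi s ^ m) \<psi>" for m
    by (induction m) (simp_all add: ket_scale_1 Fp sc ket_scale_scale)
  from this[of p] show "(?F ^^ (p * p)) \<psi> = \<psi>"
    by (simp add: funpow_mult chi_power_p ket_scale_1)
qed

text \<open>A nonzero shift leaves no diagonal entries. Without shift, the diagonal sums the
  character v \<mapsto> \<chi>(b.v), which is trivial only for b = 0.\<close>

lemma trace_E:
  assumes "x \<in> pwords N"
  shows "(\<Sum>u\<in>words N. E N x u u) = (if x = pzero N then of_nat (CARD('b) ^ N) else 0)"
proof -
  obtain a b where x: "x = (a, b)"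
    by (cases x)
  with assms have W: "a \<in> words N" "b \<in> words N"
    by auto
  have self: "u = wadd u a \<longleftrightarrow> a = wzero N" if u: "u \<in> words N" for u
  proof -
    have "wadd (wzero N) u = wadd a u \<longleftrightarrow> wzero N = a"
      by (rule wadd_right_cancel[OF wzero_words W(1) u])
    then show ?thesis
      using u W by (auto simp: wadd_wzero wadd_comm[of u N a])
  qed
  have "(\<Sum>u\<in>words N. E N x u u) = (\<Sum>u\<in>words N. if a = wzero N then chi (wdot b u) else 0)"
    by (rule sum.cong) (auto simp: err_def x self)
  also have "\<dots> = (if x = pzero N then of_nat (CARD('b) ^ N) else 0)"
  proof (cases "a = wzero N \<and> b \<noteq> wzero N")
    case True
    then obtain i where i: "i < N" "b ! i \<noteq> 0"
      using words_eqI[OF W(2) wzero_words] by auto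
    obtain t where t: "chi (b ! i * t) \<noteq> 1"
      using chi_nontrivial[OF i(2)] by blast
    define s where "s = (wzero N)[i := t]"
    have s: "s \<in> words N"
      by (simp add: s_def words_iff)
    have "wdot b s = (\<Sum>j<N. if j = i then b ! i * t else 0)"
      unfolding wdot_def
      by (rule sum.cong) (use W in \<open>auto simp: s_def nth_list_update words_iff\<close>)
    then have bs: "wdot b s = b ! i * t"
      using i by simp
    have "(\<Sum>u\<in>words N. chi (wdot b u)) = 0"
      using linear_code_shift[OF linear_code_words s]
      by (rule sum_eq_0_if_rotated[where c = "chi (wdot b s)"])
        (use s W t bs in \<open>simp_all add: wdot_wadd[of _ N] chi_add\<close>)
    then show ?thesis
      using True by (simp add: x)
  next
    case False
    then show ?thesis
      by (auto simp: x wdot_wzero card_words)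
  qed
  finally show ?thesis .
qed

end

section \<open>The code attached to an isotropic group of labels\<close>

text \<open>\<open>D\<close> is an additive group, and isotropy is stated after applying the
  character, which is exactly commutation of the errors.\<close>

locale isotropic_code = field_card_prime_power p r field_type
  for p r :: nat and field_type :: "'b::{finite,field} itself" +
  fixes N :: nat and D :: "('b list \<times> 'b list) set"
  assumes D_words: "D \<subseteq> pwords N"
    and D_zero: "pzero N \<in> D"
    and D_padd: "x \<in> D \<Longrightarrow> y \<in> D \<Longrightarrow> padd x y \<in> D"
    and D_pneg: "x \<in> D \<Longrightarrow> pneg x \<in> D"
    and isotropic: "x \<in> D \<Longrightarrow> y \<in> D \<Longrightarrow> cocycle x y = cocycle y x"
begin

abbreviation W :: "'b list set"
  where "W \<equiv> words N"

lemma D_pwords: "x \<in> D \<Longrightarrow> x \<in> pwords N"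
  using D_words by blast

lemma finite_D: "finite D"
  by (rule finite_subset[OF D_words]) (simp add: finite_words)

lemma D_shift: "x \<in> D \<Longrightarrow> bij_betw (padd x) D D"
  by (rule bij_betwI[where g = "padd (pneg x)"])
    (auto simp: D_padd D_pneg padd_pneg_cancel[of _ N] D_pwords)

lemma E_commute:
  assumes "x \<in> D" "y \<in> D"
  shows "op_mult W (E N x) (E N y) = op_mult W (E N y) (E N x)"
  using isotropic[OF assms] padd_comm[of x N y]
  by (simp add: E_mult D_pwords assms)

lemma common_E_eigenvector:
  "\<exists>\<psi>\<in>kets W. \<psi> \<noteq> (\<lambda>u. 0) \<and> (\<forall>x\<in>D. \<exists>z. op_apply W (E N x) \<psi> = ket_scale z \<psi>)"
proof -
  have "\<exists>\<psi>\<in>kets W. \<psi> \<noteq> (\<lambda>u. 0) \<and> (\<forall>A\<in>E N ` D. \<exists>z. op_apply W A \<psi> = ket_scale z \<psi>)"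
  proof (rule common_eigenvector)
    show "W \<noteq> {}"
      using wzero_words by blast
    show "\<exists>M>0. \<forall>\<psi>\<in>kets W. (op_apply W A ^^ M) \<psi> = \<psi>" if "A \<in> E N ` D" for A
      using that E_periodic[OF D_pwords] prime_gt_0_nat[OF prime_p]
      by (intro exI[of _ "p * p"]) auto
  qed (auto simp: finite_D finite_words E_commute intro: E_in_opers[OF D_pwords])
  then show ?thesis
    by blast
qed

definition psi :: "'b list ket"
  where "psi = (SOME \<psi>. \<psi> \<in> kets W \<and> \<psi> \<noteq> (\<lambda>u. 0) \<and>
    (\<forall>x\<in>D. \<exists>z. op_apply W (E N x) \<psi> = ket_scale z \<psi>))"

lemma psi: "psi \<in> kets W" "psi \<noteq> (\<lambda>u. 0)"
  and psi_eigen: "x \<in> D \<Longrightarrow> \<exists>z. op_apply W (E N x) psi = ket_scale z psi"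
  using someI_ex[of "\<lambda>\<psi>. \<psi> \<in> kets W \<and> \<psi> \<noteq> (\<lambda>u. 0) \<and>
    (\<forall>x\<in>D. \<exists>z. op_apply W (E N x) \<psi> = ket_scale z \<psi>)"] common_E_eigenvector
  unfolding psi_def[symmetric] by blast+

text \<open>The argument is an operator and not a label, since \<open>eig\<close> also serves as the
  character of the stabilizer group.\<close>

definition eig :: "'b list oper \<Rightarrow> complex"
  where "eig A = (THE z. op_apply W A psi = ket_scale z psi)"

lemma eig_eqI: "op_apply W A psi = ket_scale z psi \<Longrightarrow> eig A = z"
  unfolding eig_def by (rule the_equality) (auto intro: ket_scale_cancel[OF _ psi(2)])

lemma apply_E_psi: "x \<in> D \<Longrightarrow> op_apply W (E N x) psi = ket_scale (eig (E N x)) psi"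
  using psi_eigen eig_eqI by blast

lemma eig_scale_E: "x \<in> D \<Longrightarrow> eig (op_scale c (E N x)) = c * eig (E N x)"
  by (rule eig_eqI) (simp add: op_apply_scale apply_E_psi ket_scale_scale)

text \<open>Both sides are the eigenvalue of the product of the two errors at \<open>psi\<close>.
  The eigenvalues thus carry the same cocycle as the errors.\<close>

lemma eig_E_mult:
  assumes "x \<in> D" "y \<in> D"
  shows "eig (E N x) * eig (E N y) = cocycle x y * eig (E N (padd x y))"
proof -
  have "op_apply W (op_mult W (E N x) (E N y)) psi = ket_scale (eig (E N x) * eig (E N y)) psi"
    by (simp add: op_apply_op_mult apply_E_psi assms op_apply_ket_scale ket_scale_scale mult.commute)
  moreover have "op_apply W (op_mult W (E N x) (E N y)) psi
      = ket_scale (cocycle x y * eig (E N (padd x y))) psi"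
    by (simp add: E_mult D_pwords assms op_apply_scale apply_E_psi D_padd ket_scale_scale)
  ultimately show ?thesis
    using ket_scale_cancel[OF _ psi(2)] by metis
qed

text \<open>Errors have finite order, so the eigenvalue is a root of unity.\<close>

lemma norm_eig_E:
  assumes "x \<in> D"
  shows "norm (eig (E N x)) = 1"
proof -
  have "(op_apply W (E N x) ^^ k) psi = ket_scale (eig (E N x) ^ k) psi" for k
    by (induction k) (simp_all add: ket_scale_1 op_apply_ket_scale apply_E_psi assms ket_scale_scale mult.commute)
  from this[of "p * p"] have "ket_scale (eig (E N x) ^ (p * p)) psi = ket_scale 1 psi"
    using E_periodic[OF D_pwords[OF assms]] psi(1) by (simp add: ket_scale_1)
  then have "eig (E N x) ^ (p * p) = 1"
    by (rule ket_scale_cancel[OF _ psi(2)])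
  then have "norm (eig (E N x)) ^ (p * p) = 1"
    by (metis norm_one norm_power)
  then show ?thesis
    using prime_gt_0_nat[OF prime_p] power_eq_imp_eq_base[of "norm (eig (E N x))" "p * p" 1] by simp
qed

lemma cnj_eig_E: "x \<in> D \<Longrightarrow> cnj (eig (E N x)) * eig (E N x) = 1"
  using complex_norm_square[of "eig (E N x)"] by (simp add: norm_eig_E mult.commute)

text \<open>The conjugate is the inverse of the eigenvalue, which has modulus 1; the cocycles of
  eigenvalue and error cancel in products.\<close>

definition T :: "'b list \<times> 'b list \<Rightarrow> 'b list oper"
  where "T x = op_scale (cnj (eig (E N x))) (E N x)"

lemma T_in_opers: "x \<in> D \<Longrightarrow> T x \<in> opers W"
  by (simp add: T_def op_scale_in_opers E_in_opers D_pwords)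

lemma T_mult:
  assumes "x \<in> D" "y \<in> D"
  shows "op_mult W (T x) (T y) = T (padd x y)"
proof -
  have "cnj (eig (E N x)) * cnj (eig (E N y)) * cocycle x y
      = cnj (eig (E N x) * eig (E N y)) * cocycle x y"
    by simp
  also have "\<dots> = (cnj (cocycle x y) * cocycle x y) * cnj (eig (E N (padd x y)))"
    unfolding eig_E_mult[OF assms] by simp
  also have "cnj (cocycle x y) * cocycle x y = 1"
    using complex_norm_square[of "cocycle x y"] by (simp add: cocycle_def norm_add_char mult.commute)
  finally show ?thesis
    by (simp add: T_def E_mult D_pwords assms mult_ac)
qed

lemma eig_id: "eig (op_id W) = 1"
  by (rule eig_eqI) (simp add: op_apply_id finite_words psi ket_scale_1)

lemma T_zero: "T (pzero N) = op_id W"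
  by (simp add: T_def E_zero eig_id)

text \<open>\<open>T x\<close> is unitary, and \<open>T (pneg x)\<close> is its inverse in the
  representation.\<close>

lemma op_adj_T:
  assumes "x \<in> D"
  shows "op_adj (T x) = T (pneg x)"
proof -
  have adj: "op_mult W (op_adj (T x)) (T x) = op_id W"
    using cnj_eig_E[OF assms]
    by (simp add: T_def op_adj_scale E_unitary D_pwords assms mult.commute)
  have "op_adj (T x) = op_mult W (op_adj (T x)) (op_mult W (T x) (T (pneg x)))"
    by (simp add: T_mult assms D_pneg padd_pneg[of _ N] D_pwords T_zero op_mult_id finite_words
        op_adj_in_opers T_in_opers)
  also have "\<dots> = T (pneg x)"
    by (simp add: adj op_mult_id finite_words T_in_opers assms D_pneg flip: op_mult_assoc)
  finally show ?thesis .
qed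

definition proj :: "'b list oper"
  where "proj = (\<lambda>u v. (\<Sum>x\<in>D. T x u v) / of_nat (card D))"

lemma card_D: "card D > 0"
  using D_zero finite_D by (auto simp: card_gt_0_iff)

lemma proj_in_opers: "proj \<in> opers W"
  using T_in_opers by (auto simp: proj_def opers_def intro!: sum.neutral)

lemma op_mult_proj:
  "op_mult W A proj = (\<lambda>u w. (\<Sum>x\<in>D. op_mult W A (T x) u w) / of_nat (card D))"
  "op_mult W proj A = (\<lambda>u w. (\<Sum>x\<in>D. op_mult W (T x) A u w) / of_nat (card D))"
proof -
  have "(\<Sum>v\<in>W. A u v * (\<Sum>x\<in>D. T x v w)) = (\<Sum>x\<in>D. \<Sum>v\<in>W. A u v * T x v w)" for u w
    unfolding sum_distrib_left by (rule sum.swap)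
  then show "op_mult W A proj = (\<lambda>u w. (\<Sum>x\<in>D. op_mult W A (T x) u w) / of_nat (card D))"
    by (simp add: op_mult_def proj_def flip: sum_divide_distrib)
  have "(\<Sum>v\<in>W. (\<Sum>x\<in>D. T x u v) * A v w) = (\<Sum>x\<in>D. \<Sum>v\<in>W. T x u v * A v w)" for u w
    unfolding sum_distrib_right by (rule sum.swap)
  then show "op_mult W proj A = (\<lambda>u w. (\<Sum>x\<in>D. op_mult W (T x) A u w) / of_nat (card D))"
    by (simp add: op_mult_def proj_def flip: sum_divide_distrib)
qed

text \<open>Translation by \<open>x\<close> permutes \<open>D\<close>, so the average absorbs
  \<open>T x\<close> on either side.\<close>

lemma T_proj:
  assumes "x \<in> D"
  shows "op_mult W (T x) proj = proj" and "op_mult W proj (T x) = proj"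
proof -
  have shift: "(\<Sum>y\<in>D. T (padd x y) u w) = (\<Sum>y\<in>D. T y u w)" for u w
    by (rule sum.reindex_bij_betw[OF D_shift[OF assms]])
  have "(\<Sum>y\<in>D. op_mult W (T x) (T y) u w) = (\<Sum>y\<in>D. T y u w)" for u w
    unfolding shift[symmetric] by (rule sum.cong) (simp_all add: T_mult assms)
  then show "op_mult W (T x) proj = proj"
    unfolding op_mult_proj by (simp add: proj_def)
  have "(\<Sum>y\<in>D. op_mult W (T y) (T x) u w) = (\<Sum>y\<in>D. T y u w)" for u w
    unfolding shift[symmetric]
    by (rule sum.cong) (simp_all add: T_mult assms padd_comm[of _ N x] D_pwords)
  then show "op_mult W proj (T x) = proj"
    unfolding op_mult_proj by (simp add: proj_def)
qed

lemma proj_idem: "op_mult W proj proj = proj"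
  using card_D unfolding op_mult_proj(2)[of proj] by (simp add: T_proj cong: sum.cong)

lemma op_adj_proj: "op_adj proj = proj"
proof (intro ext)
  fix u v
  have "bij_betw pneg D D"
  proof (rule bij_betwI[where g = pneg])
    show "pneg (pneg x) = x" if "x \<in> D" for x
      using D_pwords[OF that]
      by (auto simp: pneg_def wscale_words wscale_nth[of _ N] intro!: words_eqI[of _ N])
    then show "pneg (pneg x) = x" if "x \<in> D" for x
      using that .
  qed (auto simp: D_pneg)
  then have "(\<Sum>x\<in>D. T (pneg x) u v) = (\<Sum>x\<in>D. T x u v)"
    by (rule sum.reindex_bij_betw)
  moreover have "(\<Sum>x\<in>D. T (pneg x) u v) = (\<Sum>x\<in>D. cnj (T x v u))"
    by (rule sum.cong) (simp_all add: op_adj_def flip: op_adj_T)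
  ultimately show "op_adj proj u v = proj u v"
    by (simp add: op_adj_def proj_def)
qed

definition code :: "'b list ket set"
  where "code = op_apply W proj ` kets W"

text \<open>The range of a group average consists of the vectors fixed by every \<open>T x\<close>,
  and being fixed by \<open>T x\<close> means having eigenvalue \<open>eig (E N x)\<close> under the
  error.\<close>

lemma code_iff: "\<psi> \<in> code \<longleftrightarrow> \<psi> \<in> kets W \<and> (\<forall>x\<in>D. op_apply W (E N x) \<psi> = ket_scale (eig (E N x)) \<psi>)"
proof
  assume "\<psi> \<in> code"
  then obtain \<phi> where \<phi>: "\<psi> = op_apply W proj \<phi>"
    by (auto simp: code_def)
  have "op_apply W (E N x) \<psi> = ket_scale (eig (E N x)) \<psi>" if x: "x \<in> D" for x
  proof -
    have "E N x = op_scale (eig (E N x)) (T x)"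
      using cnj_eig_E[OF x] by (simp add: T_def mult.commute)
    then have "op_apply W (E N x) \<psi> = ket_scale (eig (E N x)) (op_apply W (T x) \<psi>)"
      by (metis op_apply_scale)
    also have "op_apply W (T x) \<psi> = \<psi>"
      unfolding \<phi> op_apply_op_mult[symmetric] T_proj(1)[OF x] ..
    finally show ?thesis .
  qed
  then show "\<psi> \<in> kets W \<and> (\<forall>x\<in>D. op_apply W (E N x) \<psi> = ket_scale (eig (E N x)) \<psi>)"
    using op_apply_in_kets[OF proj_in_opers] \<phi> by blast
next
  assume \<psi>: "\<psi> \<in> kets W \<and> (\<forall>x\<in>D. op_apply W (E N x) \<psi> = ket_scale (eig (E N x)) \<psi>)"
  have "op_apply W proj \<psi> = \<psi>"
  proof
    fix u
    have T\<psi>: "(\<Sum>v\<in>W. T x u v * \<psi> v) = \<psi> u" if x: "x \<in> D" for x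
    proof -
      have "op_apply W (T x) \<psi> = \<psi>"
        using \<psi> x cnj_eig_E[OF x] by (simp add: T_def op_apply_scale ket_scale_scale ket_scale_1)
      then show ?thesis
        by (metis op_apply_def)
    qed
    have "op_apply W proj \<psi> u = (\<Sum>v\<in>W. \<Sum>x\<in>D. T x u v * \<psi> v) / of_nat (card D)"
      by (simp add: op_apply_def proj_def sum_distrib_right sum_divide_distrib)
    also have "(\<Sum>v\<in>W. \<Sum>x\<in>D. T x u v * \<psi> v) = (\<Sum>x\<in>D. \<Sum>v\<in>W. T x u v * \<psi> v)"
      by (rule sum.swap)
    finally show "op_apply W proj \<psi> u = \<psi> u"
      using card_D by (simp add: T\<psi>)
  qed
  then show "\<psi> \<in> code"
    using \<psi> by (metis code_def imageI)
qed

lemma orth_projector_code: "orth_projector W proj code"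
  by (simp add: orth_projector_def proj_in_opers proj_idem op_adj_proj code_def)

text \<open>In the trace of the average only the zero label contributes, by
  \<open>trace_E\<close>.\<close>

lemma dim_code: "real (ket.dim code) = real (CARD('b) ^ N) / real (card D)"
proof -
  have "of_nat (ket.dim code) = (\<Sum>u\<in>W. proj u u)"
    unfolding code_def by (rule ket_dim_eq_trace[OF finite_words proj_in_opers proj_idem])
  also have "\<dots> = (\<Sum>u\<in>W. \<Sum>x\<in>D. T x u u) / of_nat (card D)"
    by (simp add: proj_def sum_divide_distrib)
  also have "(\<Sum>u\<in>W. \<Sum>x\<in>D. T x u u) = (\<Sum>x\<in>D. \<Sum>u\<in>W. T x u u)"
    by (rule sum.swap)
  also have "\<dots> = (\<Sum>x\<in>D. if x = pzero N then of_nat (CARD('b) ^ N) else 0)"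
  proof (rule sum.cong)
    fix x assume x: "x \<in> D"
    have "(\<Sum>u\<in>W. T x u u) = cnj (eig (E N x)) * (\<Sum>u\<in>W. E N x u u)"
      by (simp add: T_def op_scale_def sum_distrib_left)
    then show "(\<Sum>u\<in>W. T x u u) = (if x = pzero N then of_nat (CARD('b) ^ N) else 0)"
      using x by (simp add: trace_E D_pwords E_zero eig_id)
  qed simp
  also have "\<dots> = of_nat (CARD('b) ^ N)"
    using D_zero finite_D by simp
  finally have "complex_of_real (real (ket.dim code)) = complex_of_real (real (CARD('b) ^ N) / real (card D))"
    by simp
  then show ?thesis
    by (simp only: of_real_eq_iff)
qed

text \<open>Insert \<open>T y\<close> next to the left projector, move it past the error at the cost
  of a factor \<kappa> different from 1, and let the right projector absorb it: the product equals
  \<kappa> times itself.\<close>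

lemma detect:
  assumes e: "e \<in> pwords N" and y: "y \<in> D" "cocycle y e \<noteq> cocycle e y"
  shows "op_mult W (op_mult W proj (E N e)) proj = op_scale 0 proj"
proof -
  let ?P = "op_mult W (op_mult W proj (E N e)) proj"
  define \<kappa> where "\<kappa> = cocycle y e / cocycle e y"
  have nz: "cocycle e y \<noteq> 0"
    by (simp add: cocycle_def)
  have ye: "op_mult W (T y) (E N e) = op_scale \<kappa> (op_mult W (E N e) (T y))"
    using nz by (simp add: T_def E_mult D_pwords y e padd_comm[of e N y] \<kappa>_def mult.commute)
  have "?P = op_mult W (op_mult W proj (op_mult W (T y) (E N e))) proj"
    by (simp add: T_proj y flip: op_mult_assoc)
  also have "\<dots> = op_scale \<kappa> (op_mult W (op_mult W proj (E N e)) (op_mult W (T y) proj))"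
    by (simp add: ye op_mult_assoc)
  finally have "?P = op_scale \<kappa> ?P"
    by (simp add: T_proj y)
  then have "?P u v = \<kappa> * ?P u v" for u v
    by (metis op_scale_def)
  then have "(1 - \<kappa>) * ?P u v = 0" for u v
    by (simp add: left_diff_distrib)
  moreover have "\<kappa> \<noteq> 1"
    using y(2) nz by (simp add: \<kappa>_def)
  ultimately have "?P u v = 0" for u v
    by simp
  then show ?thesis
    by (simp add: op_scale_def fun_eq_iff)
qed

section \<open>The stabilizer group and its character\<close>

text \<open>The powers of \<open>omega p\<close> are included because products of errors produce
  cocycle phases. They leave the eigenspace unchanged, since \<open>eig\<close> maps a scalar
  operator to its scalar.\<close>

definition stab :: "'b list oper set"
  where "stab = {op_scale (omega p ^ c) (E N x) | c x. x \<in> D}"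

lemma omega_power_mod: "omega p ^ (c mod p) = omega p ^ c"
  using prime_gt_0_nat[OF prime_p] by (simp add: omega_power_eq_iff)

lemma error_group_carrier:
  "carrier (error_group p r N) = {op_scale (omega p ^ c) (E N x) | c x. x \<in> pwords N}"
proof -
  have "\<exists>c' a b. op_scale (omega p ^ c) (E N x) = error_op p r N c' a b \<and> c' < p \<and> a \<in> W \<and> b \<in> W"
    if "x \<in> pwords N" for c x
    by (rule exI[of _ "c mod p"], rule exI[of _ "fst x"], rule exI[of _ "snd x"])
      (use that prime_gt_0_nat[OF prime_p] in \<open>auto simp: error_op_eq omega_power_mod\<close>)
  then show ?thesis
    by (fastforce simp: error_group_def error_op_eq)
qed

lemma error_group_mult [simp]: "A \<otimes>\<^bsub>error_group p r N\<^esub> B = op_mult W A B"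
  by (simp add: error_group_def)

lemma error_group_one: "\<one>\<^bsub>error_group p r N\<^esub> = op_id W"
  by (simp add: error_group_def)

lemma cocycle_omega: "\<exists>c. cocycle x y = omega p ^ c"
  by (auto simp: cocycle_def add_char_def)

lemma scaled_E_mult:
  assumes "x \<in> pwords N" "y \<in> pwords N"
  shows "\<exists>c. op_mult W (op_scale (omega p ^ i) (E N x)) (op_scale (omega p ^ j) (E N y))
    = op_scale (omega p ^ c) (E N (padd x y))"
proof -
  obtain k where "cocycle x y = omega p ^ k"
    using cocycle_omega by blast
  then show ?thesis
    by (intro exI[of _ "i + j + k"]) (simp add: E_mult assms power_add mult_ac)
qed

text \<open>Provides uniqueness of inverses, so that the inverse taken in the error group can be
  identified with the element of \<open>stab\<close> found by \<open>stab_inverse\<close>.\<close>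

lemma monoid_error_group: "monoid (error_group p r N :: 'b list oper monoid)"
proof (rule monoidI)
  let ?G = "error_group p r N :: 'b list oper monoid"
  show "\<one>\<^bsub>?G\<^esub> \<in> carrier (?G)"
    unfolding error_group_carrier error_group_one
    by (rule CollectI, rule exI[of _ 0], rule exI[of _ "pzero N"]) (simp add: E_zero wzero_words)
  show "x \<otimes>\<^bsub>?G\<^esub> y \<in> carrier (?G)"
    if "x \<in> carrier (?G)" "y \<in> carrier (?G)" for x y
  proof -
    obtain i u j v where uv: "x = op_scale (omega p ^ i) (E N u)" "u \<in> pwords N"
      "y = op_scale (omega p ^ j) (E N v)" "v \<in> pwords N"
      using \<open>x \<in> _\<close> \<open>y \<in> _\<close> unfolding error_group_carrier by blast
    obtain c where "op_mult W x y = op_scale (omega p ^ c) (E N (padd u v))"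
      using scaled_E_mult[OF uv(2,4)] unfolding uv by blast
    then show ?thesis
      unfolding error_group_carrier error_group_mult using padd_pwords[OF uv(2,4)]
      by - (rule CollectI, intro exI conjI)
  qed
qed (auto simp: op_mult_assoc error_group_one error_group_carrier op_mult_id finite_words
      op_scale_in_opers E_in_opers)

lemma stab_commute: "A \<in> stab \<Longrightarrow> B \<in> stab \<Longrightarrow> op_mult W A B = op_mult W B A"
  by (auto simp: stab_def E_commute mult.commute)

lemma stab_inverse:
  assumes "A \<in> stab"
  shows "\<exists>B\<in>stab. op_mult W B A = op_id W"
proof -
  obtain c x where A: "A = op_scale (omega p ^ c) (E N x)" "x \<in> D"
    using assms by (auto simp: stab_def)
  obtain d where d: "op_mult W A (op_scale (omega p ^ 0) (E N (pneg x)))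
      = op_scale (omega p ^ d) (E N (padd x (pneg x)))"
    unfolding A(1) using scaled_E_mult[of x "pneg x"] A(2) D_pneg D_pwords by blast
  \<comment> \<open>The product of \<open>A\<close> with the error of the negated label is the
    scalar with exponent \<open>d\<close>. The exponent \<open>(p - 1) * d\<close> completes it to
    \<open>p * d\<close>, a trivial phase, without negative exponents.\<close>
  define B where "B = op_scale (omega p ^ ((p - 1) * d)) (E N (pneg x))"
  have B: "B \<in> stab"
    unfolding B_def stab_def using A(2) D_pneg by blast
  have "omega p ^ ((p - 1) * d) * omega p ^ d = omega p ^ (d * p)"
    using prime_gt_0_nat[OF prime_p] by (cases p) (simp_all add: algebra_simps flip: power_add)
  also have "\<dots> = 1"
    using omega_power_mod[of "d * p"] by simp
  finally have "op_mult W A B = op_id W"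
    using d A(2) by (simp add: B_def padd_pneg[of _ N] D_pwords E_zero)
  then show ?thesis
    using stab_commute[OF assms B] B by auto
qed

lemma subgroup_stab: "subgroup stab (error_group p r N)"
proof (rule subgroup.intro)
  show sub: "stab \<subseteq> carrier (error_group p r N)"
    unfolding error_group_carrier stab_def using D_pwords by blast
  show "x \<otimes>\<^bsub>error_group p r N\<^esub> y \<in> stab" if xy: "x \<in> stab" "y \<in> stab" for x y
  proof -
    obtain i u j v where uv: "x = op_scale (omega p ^ i) (E N u)" "u \<in> D"
      "y = op_scale (omega p ^ j) (E N v)" "v \<in> D"
      using xy unfolding stab_def by blast
    obtain c where "op_mult W x y = op_scale (omega p ^ c) (E N (padd u v))"
      using scaled_E_mult[OF uv(2,4)[THEN D_pwords]] unfolding uv by blast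
    then show ?thesis
      unfolding stab_def error_group_mult using D_padd[OF uv(2,4)]
      by - (rule CollectI, intro exI conjI)
  qed
  show "\<one>\<^bsub>error_group p r N\<^esub> \<in> stab"
    unfolding stab_def error_group_one
    by (rule CollectI, rule exI[of _ 0], rule exI[of _ "pzero N"]) (simp add: E_zero D_zero)
  show "inv\<^bsub>error_group p r N\<^esub> x \<in> stab" if x: "x \<in> stab" for x
  proof -
    obtain B where B: "B \<in> stab" "op_mult W B x = op_id W"
      using stab_inverse[OF x] by blast
    have "inv\<^bsub>error_group p r N\<^esub> x = B"
      by (rule monoid.inv_unique'[OF monoid_error_group, symmetric])
        (use B x sub stab_commute[OF B(1) x] in \<open>auto simp: error_group_one\<close>)
    then show ?thesis
      using B by simp
  qed
qed

lemma apply_stab_psi: "A \<in> stab \<Longrightarrow> op_apply W A psi = ket_scale (eig A) psi"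
  by (auto simp: stab_def eig_scale_E op_apply_scale apply_E_psi ket_scale_scale)

lemma eig_hom: "eig \<in> hom ((error_group p r N)\<lparr>carrier := stab\<rparr>) complex_units"
proof -
  have "eig A \<noteq> 0" if "A \<in> stab" for A
    using that norm_omega[of p] norm_eig_E by (auto simp: stab_def eig_scale_E) fastforce+
  moreover have "eig (op_mult W A B) = eig A * eig B" if "A \<in> stab" "B \<in> stab" for A B
    by (rule eig_eqI)
      (simp add: op_apply_op_mult apply_stab_psi that op_apply_ket_scale ket_scale_scale mult.commute)
  ultimately show ?thesis
    by (auto simp: hom_def complex_units_def)
qed

lemma code_eq_common_eigenspace: "code = common_eigenspace N stab eig"
proof (intro Set.set_eqI iffI)
  fix \<psi> assume "\<psi> \<in> code"
  then show "\<psi> \<in> common_eigenspace N stab eig"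
    by (auto simp: code_iff common_eigenspace_def stab_def eig_scale_E op_apply_scale ket_scale_scale)
next
  fix \<psi> assume \<psi>: "\<psi> \<in> common_eigenspace N stab eig"
  have "E N x \<in> stab" if "x \<in> D" for x
    unfolding stab_def by (rule CollectI, rule exI[of _ 0], rule exI[of _ x]) (simp add: that)
  then show "\<psi> \<in> code"
    using \<psi> by (auto simp: code_iff common_eigenspace_def)
qed

lemma stabilizer_code_code: "stabilizer_code p r N code"
proof -
  have "psi \<in> code"
    by (simp add: code_iff psi apply_E_psi)
  then have "code \<noteq> {\<lambda>u. 0}"
    using psi(2) by auto
  then show ?thesis
    unfolding stabilizer_code_def
    using subgroup_stab stab_commute eig_hom code_eq_common_eigenspace by blast
qed

lemma has_parameters_code:
  assumes card: "card D = CARD('b) ^ m"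
    and det: "\<And>a b. a \<in> W \<Longrightarrow> b \<in> W \<Longrightarrow> enat (error_weight N a b) < d \<Longrightarrow>
      (a, b) = pzero N \<or> (\<exists>y\<in>D. cocycle y (a, b) \<noteq> cocycle (a, b) y)"
  shows "has_parameters p r code N (int N - int m) d"
proof -
  have "real (ket.dim code) = real (p ^ r) powi (int N - int m)"
    using prime_gt_0_nat[OF prime_p]
    by (simp add: dim_code card card_field power_int_diff)
  moreover have "\<exists>z. op_mult W (op_mult W proj (error_op p r N c a b)) proj = op_scale z proj"
    if ab: "a \<in> W" "b \<in> W" "enat (error_weight N a b) < d" for c a b
  proof (cases "(a, b) = pzero N")
    case True
    then have "op_mult W (op_mult W proj (error_op p r N c a b)) proj = op_scale (omega p ^ c) proj"
      using ab by (simp add: error_op_eq E_zero op_mult_id finite_words proj_in_opers proj_idem)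
    then show ?thesis
      by blast
  next
    case False
    then obtain y where "y \<in> D" "cocycle y (a, b) \<noteq> cocycle (a, b) y"
      using det[OF ab] by blast
    then have "op_mult W (op_mult W proj (E N (a, b))) proj = op_scale 0 proj"
      using ab by (intro detect) auto
    then have "op_mult W (op_mult W proj (error_op p r N c a b)) proj = op_scale 0 proj"
      using ab by (simp add: error_op_eq)
    then show ?thesis
      by blast
  qed
  ultimately show ?thesis
    unfolding has_parameters_def using orth_projector_code by blast
qed

end

section \<open>Symplectic coordinates and the theorem\<close>

text \<open>
  Writing the elements of the larger field as \<open>s + t \<beta>\<close> with \<open>s\<close> and \<open>t\<close> in the smaller one,
  the form \<open>x^q y - y^q x\<close> becomes \<open>\<beta> - \<beta>^q\<close> times the standard symplectic form.
  The map \<open>\<delta>\<close> is the multiplication by \<open>\<beta> - \<beta>^q\<close>, so \<open>\<beta> t - (\<beta> t)^q = \<delta> t\<close>.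
\<close>

lemma symplectic_coordinates:
  assumes p: "prime p" and q: "q = p ^ r" and cb: "CARD('b::{finite,field}) = q"
    and ca: "CARD('a::{finite,field}) = q\<^sup>2"
  obtains al be :: "'a::{finite,field} \<Rightarrow> 'b::{finite,field}" and \<delta> :: "'b \<Rightarrow> 'a"
  where "\<And>x y. al (x + y) = al x + al y" and "\<And>x y. be (x + y) = be x + be y"
    and "bij (\<lambda>x. (al x, be x))"
    and "\<And>x y. x ^ q * y - y ^ q * x = \<delta> (al x * be y - be x * al y)"
    and "\<And>s t. \<delta> (s + t) = \<delta> s + \<delta> t" and "inj \<delta>" and "\<And>t. \<exists>w. w - w ^ q = \<delta> t"
proof -
  obtain \<iota> :: "'b \<Rightarrow> 'a" where \<iota>1: "\<iota> 1 = 1" and add: "\<And>x y. \<iota> (x + y) = \<iota> x + \<iota> y"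
    and mult: "\<And>x y. \<iota> (x * y) = \<iota> x * \<iota> y" and inj: "inj \<iota>"
    using finite_field_embedding[OF p, of r 2, where 'b = 'b and 'a = 'a] q cb ca by auto
  have diff: "\<iota> (x - y) = \<iota> x - \<iota> y" for x y
    using add[of "x - y" y] by simp
  have zero: "\<iota> 0 = 0"
    using diff[of 0 0] by simp
  have \<iota>_0_iff: "\<iota> x = 0 \<longleftrightarrow> x = 0" for x
    using inj zero by (metis injD)
  have \<iota>_power: "\<iota> (x ^ k) = \<iota> x ^ k" for x and k :: nat
    by (induction k) (simp_all add: \<iota>1 mult)
  have \<iota>q: "\<iota> x ^ q = \<iota> x" for x
    using power_card_field[of x] by (simp add: cb flip: \<iota>_power)
  have q2: "q \<ge> 2"
  proof -
    have "card {0, 1 :: 'b} \<le> CARD('b)" by (rule card_mono) auto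
    then show ?thesis by (simp add: cb)
  qed
  have powq: "(x + y) ^ q = x ^ q + y ^ q" for x y :: 'a
    by (rule freshmans_dream'[where n = r])
      (simp_all add: CHAR_of_card_prime_power[OF p, of "2 * r"] p q ca power_mult mult.commute)
  have "q < CARD('a)"
    using q2 by (simp add: ca power2_eq_square)
  then have "card (range \<iota>) < CARD('a)"
    using card_image[OF inj] by (simp add: cb)
  \<comment> \<open>With 1, any element outside the embedded F_q forms a basis: in a coincidence of
    two combinations with different coefficients at \<beta>, \<beta> would be a quotient of embedded
    elements.\<close>
  then obtain \<beta> where \<beta>: "\<beta> \<notin> range \<iota>"
    by (metis UNIV_eq_I less_irrefl)
  define c where "c = (\<lambda>(s, t). \<iota> s + \<iota> t * \<beta>)"
  have c_eq: "c (s, t) = c (s', t') \<Longrightarrow> s = s' \<and> t = t'" for s t s' t'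
  proof (rule ccontr)
    assume eq: "c (s, t) = c (s', t')" and ne: "\<not> (s = s' \<and> t = t')"
    have e: "\<iota> (s - s') = \<iota> (t' - t) * \<beta>"
      using eq by (simp add: c_def diff algebra_simps)
    show False
    proof (cases "t' = t")
      case True
      then show False
        using e ne by (simp add: zero \<iota>_0_iff)
    next
      case False
      then have "\<beta> = \<iota> ((s - s') / (t' - t))"
      proof -
        have "\<iota> (t' - t) * \<iota> ((s - s') / (t' - t)) = \<iota> (s - s')"
          using False by (simp flip: mult)
        then have "\<iota> (t' - t) * \<iota> ((s - s') / (t' - t)) = \<iota> (t' - t) * \<beta>"
          by (simp add: e)
        then show ?thesis
          using False \<iota>_0_iff[of "t' - t"] by simp
      qed
      with \<beta> show False
        by blast
    qed
  qed
  then have "inj c"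
    by (intro injI) auto
  \<comment> \<open>Spanning follows by counting, as both sides have q^2 elements.\<close>
  have "card (range c) = CARD('b \<times> 'b)"
    by (rule card_image[OF \<open>inj c\<close>])
  also have "\<dots> = CARD('a)"
    by (simp only: card_prod cb ca power2_eq_square)
  finally have "range c = UNIV"
    by (intro card_subset_eq) auto
  with \<open>inj c\<close> have bij: "bij c"
    by (simp add: bij_def)
  define al be where "al x = fst (inv_into UNIV c x)" and "be x = snd (inv_into UNIV c x)" for x
  have coords: "\<iota> (al x) + \<iota> (be x) * \<beta> = x" for x
  proof -
    have "c (al x, be x) = x"
      using bij by (simp add: al_def be_def bij_is_surj surj_f_inv_f)
    then show ?thesis
      by (simp add: c_def)
  qed
  have add': "al (x + y) = al x + al y \<and> be (x + y) = be x + be y" for x y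
  proof (rule c_eq)
    have "c (al x + al y, be x + be y) = (\<iota> (al x) + \<iota> (be x) * \<beta>) + (\<iota> (al y) + \<iota> (be y) * \<beta>)"
      by (simp add: c_def add algebra_simps)
    also have "\<dots> = c (al (x + y), be (x + y))"
      unfolding coords using coords[of "x + y"] by (simp add: c_def)
    finally show "c (al (x + y), be (x + y)) = c (al x + al y, be x + be y)" ..
  qed
  \<comment> \<open>Otherwise the \<open>q\<close>-th power map would fix every s + t \<beta>, and
    X^q - X would have q^2 roots.\<close>
  have "\<beta> ^ q \<noteq> \<beta>"
  proof
    assume \<beta>q: "\<beta> ^ q = \<beta>"
    let ?P = "monom 1 q - monom 1 1 :: 'a poly"
    have "coeff ?P q \<noteq> 0"
      using q2 by simp
    then have P0: "?P \<noteq> 0"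
      by (metis coeff_0)
    have "x ^ q = x" for x :: 'a
    proof -
      have "(\<iota> (al x) + \<iota> (be x) * \<beta>) ^ q = \<iota> (al x) + \<iota> (be x) * \<beta>"
        by (simp add: powq power_mult_distrib \<iota>q \<beta>q)
      then show ?thesis
        by (simp only: coords)
    qed
    then have "{x. poly ?P x = 0} = UNIV"
      by (simp add: poly_monom)
    then have "CARD('a) \<le> degree ?P"
      using card_poly_roots_bound[OF P0] by simp
    also have "\<dots> \<le> q"
      using q2 by (intro degree_diff_le) (auto simp: degree_monom_eq)
    finally show False
      using \<open>q < CARD('a)\<close> by simp
  qed
  define \<delta> where "\<delta> t = (\<beta> - \<beta> ^ q) * \<iota> t" for t
  have "x ^ q * y - y ^ q * x = \<delta> (al x * be y - be x * al y)" for x y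
  proof -
    have "(\<iota> a + \<iota> b * \<beta>) ^ q * (\<iota> a' + \<iota> b' * \<beta>) - (\<iota> a' + \<iota> b' * \<beta>) ^ q * (\<iota> a + \<iota> b * \<beta>)
        = \<delta> (a * b' - b * a')" for a b a' b'
      by (simp add: \<delta>_def powq power_mult_distrib \<iota>q diff mult algebra_simps)
    from this[of "al x" "be x" "al y" "be y"] show ?thesis
      by (simp only: coords)
  qed
  moreover have "inj \<delta>"
    using \<open>\<beta> ^ q \<noteq> \<beta>\<close> inj by (auto simp: \<delta>_def inj_def)
  moreover have "\<exists>w. w - w ^ q = \<delta> t" for t
    by (rule exI[of _ "\<iota> t * \<beta>"]) (simp add: \<delta>_def power_mult_distrib \<iota>q algebra_simps)
  moreover have "bij (\<lambda>x. (al x, be x))"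
    using bij_imp_bij_inv[OF bij] by (simp add: al_def be_def)
  moreover have "\<delta> (s + t) = \<delta> s + \<delta> t" for s t
    by (simp add: \<delta>_def add algebra_simps)
  ultimately show thesis
    using that[of al be \<delta>] add' by blast
qed

lemma wdot_comm: "length x = length y \<Longrightarrow> wdot x y = wdot y x"
  by (simp add: wdot_def mult.commute)

theorem theorem15:
  fixes p r q n :: nat
    and f g h :: "'a::{finite,field_gcd} poly"
  assumes "prime p" and "r \<ge> 1" and "q = p ^ r"
    and "CARD('a) = q ^ 2" and "CARD('b::{finite,field}) = q"
    and "n \<ge> 1"
    and "lead_coeff f = 1" and "lead_coeff g = 1" and "lead_coeff h = 1"
    and "degree f < n" and "degree g < n" and "degree h < n"
    and "f dvd xn1 n" and "g dvd xn1 n"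
    and "f dvd g"
    and "g dvd perp_poly n (frob_poly q g)"
    and "perp_poly n (frob_poly q g) dvd perp_poly n (frob_poly q f)"
  shows "herm_dual q (2 * n) (qc_code n f g h) \<subseteq> qc_code n f g h \<and>
    (\<exists>C :: 'b list ket set.
       stabilizer_code p r (2 * n) C \<and>
       has_parameters p r C (2 * n)
         (2 * int n - 2 * int (degree f) - 2 * int (degree g))
         (de_bound n f g h))"
proof
  interpret A: hermitian_space p r "TYPE('a)" q
    by unfold_locales (use assms in \<open>simp_all add: power_mult mult.commute\<close>)
  interpret B: field_card_prime_power p r "TYPE('b)"
    by unfold_locales (use assms in simp_all)
  let ?N = "2 * n" and ?Q = "qc_code n f g h"
  define K where "K = herm_dual q ?N ?Q"
  show sub: "herm_dual q ?N ?Q \<subseteq> ?Q"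
    by (rule A.herm_dual_qc_code_subset) (use assms in simp_all)
  have Q: "linear_code ?N ?Q"
    by (rule linear_code_qc_code)
  have K: "linear_code ?N K"
    unfolding K_def using Q by (intro A.linear_code_herm_dual) (simp add: linear_code_def)
  have K_words: "x \<in> words ?N" if "x \<in> K" for x
    using K that by (auto simp: linear_code_def)
  have dual_K: "herm_dual q ?N K = ?Q"
    unfolding K_def by (rule A.herm_dual_herm_dual[OF Q])
  \<comment> \<open>Self-orthogonality enters here: \<open>K\<close> is contained in
    \<open>?Q\<close> and orthogonal to it.\<close>
  have K_orth: "herm_inner q x y = 0" if "x \<in> K" "y \<in> K" for x y
    using that sub unfolding K_def by (metis A.herm_dual_iff subsetD)
  have card_K: "card K = q ^ (2 * (degree f + degree g))"
  proof -
    have "card ?Q * card K = CARD('a) ^ ?N"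
      unfolding K_def by (rule A.card_herm_dual[OF Q])
    moreover have "card ?Q = CARD('a) ^ (n - degree f + (n - degree g))"
      by (rule card_qc_code) (use assms in simp_all)
    \<comment> \<open>The exponent is split so that the size of \<open>?Q\<close> can be cancelled;
      both degrees are below \<open>n\<close>, so the truncated differences are genuine.\<close>
    moreover have "?N = (n - degree f + (n - degree g)) + (degree f + degree g)"
      using assms by simp
    ultimately have "CARD('a) ^ (n - degree f + (n - degree g)) * card K
        = CARD('a) ^ (n - degree f + (n - degree g)) * CARD('a) ^ (degree f + degree g)"
      by (metis power_add)
    then have "card K = CARD('a) ^ (degree f + degree g)"
      by simp
    then show ?thesis
      by (simp add: assms(4) flip: power_mult)
  qed
  obtain al be :: "'a \<Rightarrow> 'b" and \<delta> :: "'b \<Rightarrow> 'a"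
    where al: "\<And>x y. al (x + y) = al x + al y" and be: "\<And>x y. be (x + y) = be x + be y"
      and bij: "bij (\<lambda>x. (al x, be x))"
      and symp: "\<And>x y. x ^ q * y - y ^ q * x = \<delta> (al x * be y - be x * al y)"
      and \<delta>_add: "\<And>s t. \<delta> (s + t) = \<delta> s + \<delta> t" and \<delta>_inj: "inj \<delta>"
      and \<delta>_ex: "\<And>t. \<exists>w. w - w ^ q = \<delta> t"
    using symplectic_coordinates[OF assms(1,3,5,4)] by blast
  have \<delta>_0: "\<delta> 0 = 0"
    using \<delta>_add[of 0 0] by (metis add_0_right add_left_imp_eq)
  have al0: "al 0 = 0" and be0: "be 0 = 0"
    using al[of 0 0] be[of 0 0] by (metis add_0_right add_left_imp_eq)+
  have al_neg: "al (- x) = - al x" and be_neg: "be (- x) = - be x" for x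
    using al[of "- x" x] be[of "- x" x] by (simp_all add: al0 be0 eq_neg_iff_add_eq_0)
  \<comment> \<open>Translates words over F_{q^2} into error labels position by position. An entry
    vanishes exactly when both of its coordinates do, so the Hamming weight becomes the error
    weight.\<close>
  define \<Phi> where "\<Phi> x = (map al x, map be x)" for x
  have map_words: "map al x \<in> words ?N" "map be x \<in> words ?N" if "x \<in> words ?N" for x
    using that by (simp_all add: words_iff)
  have form: "herm_inner q x y - herm_inner q y x
      = \<delta> (wdot (map al x) (map be y) - wdot (map be x) (map al y))"
    if "x \<in> words ?N" "y \<in> words ?N" for x y
  proof -
    have \<delta>_sum: "\<delta> (sum u S) = (\<Sum>i\<in>S. \<delta> (u i))" for u :: "nat \<Rightarrow> 'b" and S
      by (induction S rule: infinite_finite_induct) (simp_all add: \<delta>_0 \<delta>_add)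
    have "herm_inner q x y - herm_inner q y x
        = (\<Sum>i<?N. (x ! i) ^ q * y ! i - (y ! i) ^ q * x ! i)"
      using that by (simp add: herm_inner_def words_iff sum_subtractf)
    also have "\<dots> = \<delta> (\<Sum>i<?N. al (x ! i) * be (y ! i) - be (x ! i) * al (y ! i))"
      by (simp only: symp \<delta>_sum)
    also have "(\<Sum>i<?N. al (x ! i) * be (y ! i) - be (x ! i) * al (y ! i))
        = wdot (map al x) (map be y) - wdot (map be x) (map al y)"
      using that by (simp add: wdot_def words_iff sum_subtractf)
    finally show ?thesis .
  qed
  have cocycle_\<Phi>: "B.cocycle (\<Phi> x) (\<Phi> y) = add_char p r (wdot (map be x) (map al y))" for x y
    by (simp add: \<Phi>_def B.cocycle_def)
  have cocycle_swap: "B.cocycle (\<Phi> y) (\<Phi> x) = add_char p r (wdot (map al x) (map be y))"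
    if "x \<in> words ?N" "y \<in> words ?N" for x y
    using that wdot_comm[of "map al x" "map be y"] by (simp add: cocycle_\<Phi> words_iff)
  interpret S: isotropic_code p r "TYPE('b)" ?N "\<Phi> ` K"
  proof
    show "\<Phi> ` K \<subseteq> pwords ?N"
      using K_words map_words by (auto simp: \<Phi>_def)
    have "\<Phi> (wzero ?N) = pzero ?N"
      by (simp add: \<Phi>_def al0 be0)
    then show "pzero ?N \<in> \<Phi> ` K"
      using K by (metis image_eqI linear_code_def)
    fix u assume u: "u \<in> \<Phi> ` K"
    then obtain x where x: "u = \<Phi> x" "x \<in> K"
      by blast
    have "pneg u = \<Phi> (wscale (- 1) x)"
      by (simp add: x \<Phi>_def pneg_def wscale_def al_neg be_neg)
    then show "pneg u \<in> \<Phi> ` K"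
      using K x by (simp add: linear_code_def)
    fix v assume v: "v \<in> \<Phi> ` K"
    then obtain y where y: "v = \<Phi> y" "y \<in> K"
      by blast
    have "padd u v = \<Phi> (wadd x y)"
      using K_words[OF x(2)] K_words[OF y(2)]
      by (auto simp: x y \<Phi>_def padd_def wadd_def words_iff al be intro!: nth_equalityI)
    then show "padd u v \<in> \<Phi> ` K"
      using K x y by (simp add: linear_code_def)
    \<comment> \<open>Both Hermitian products of \<open>x\<close> and \<open>y\<close> are zero,
      hence so is their difference, which is \<delta> of the symplectic form.\<close>
    have "\<delta> (wdot (map al x) (map be y) - wdot (map be x) (map al y)) = \<delta> 0"
      using form[of x y] x y K_words K_orth by (simp add: \<delta>_0)
    then have "wdot (map al x) (map be y) = wdot (map be x) (map al y)"
      using \<delta>_inj by (metis eq_iff_diff_eq_0 injD)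
    then show "B.cocycle u v = B.cocycle v u"
      using cocycle_swap[of x y] K_words x y by (simp add: cocycle_\<Phi>)
  qed
  have bij_coords: "x = y" if "al x = al y" "be x = be y" for x y
    using bij that by (auto dest: bij_is_inj injD)
  have "inj_on \<Phi> K"
  proof (rule inj_onI)
    fix x y assume xy: "x \<in> K" "y \<in> K" "\<Phi> x = \<Phi> y"
    have len: "length x = ?N" "length y = ?N"
      using K_words xy by (simp_all add: words_iff)
    have maps: "map al x = map al y" "map be x = map be y"
      using xy(3) by (simp_all add: \<Phi>_def)
    show "x = y"
    proof (rule nth_equalityI)
      fix i assume "i < length x"
      then show "x ! i = y ! i"
        using arg_cong[OF maps(1), of "\<lambda>l. l ! i"] arg_cong[OF maps(2), of "\<lambda>l. l ! i"] len
        by (intro bij_coords) simp_all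
    qed (simp add: len)
  qed
  then have "card (\<Phi> ` K) = CARD('b) ^ (2 * (degree f + degree g))"
    by (simp add: card_image card_K assms(5))
  then have "has_parameters p r S.code ?N (int ?N - int (2 * (degree f + degree g))) (de_bound n f g h)"
  proof (rule S.has_parameters_code)
    fix a b :: "'b list"
    assume ab: "a \<in> words ?N" "b \<in> words ?N"
      and wt: "enat (error_weight ?N a b) < de_bound n f g h"
    show "(a, b) = pzero ?N \<or> (\<exists>y\<in>\<Phi> ` K. B.cocycle y (a, b) \<noteq> B.cocycle (a, b) y)"
    proof (rule ccontr)
      assume contra: "\<not> ?thesis"
      \<comment> \<open>The word over F_{q^2} whose label is \<open>(a, b)\<close>. If the error
        commutes with the whole group, \<open>z\<close> will turn out to be a nonzero word of
        \<open>?Q\<close>, too light for the distance bound.\<close>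
      define z where "z = map (\<lambda>i. inv_into UNIV (\<lambda>x. (al x, be x)) (a ! i, b ! i)) [0..<?N]"
      have z_words: "z \<in> words ?N"
        by (simp add: z_def words_iff)
      have z_nth: "(al (z ! i), be (z ! i)) = (a ! i, b ! i)" if "i < ?N" for i
        using that bij surj_f_inv_f[of "\<lambda>x. (al x, be x)" "(a ! i, b ! i)"]
        by (simp add: z_def bij_is_surj)
      have \<Phi>z: "\<Phi> z = (a, b)"
        using ab z_words z_nth by (auto simp: \<Phi>_def words_iff intro!: nth_equalityI)
      have "herm_inner q z y = 0" if y: "y \<in> K" for y
      proof (rule ccontr)
        assume nz: "herm_inner q z y \<noteq> 0"
        \<comment> \<open>Rescaling \<open>y\<close> within \<open>K\<close> moves its product with
          \<open>z\<close> to a \<open>w\<close> satisfying \<open>w - w ^ q = \<delta> t\<close>.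
          The symplectic product then equals \<open>t\<close>, and commutation forces the character
          to be 1 at the arbitrary element \<open>t\<close>.\<close>
        have "add_char p r t = 1" for t :: 'b
        proof -
          obtain w where w: "w - w ^ q = \<delta> t"
            using \<delta>_ex by blast
          define y' where "y' = wscale (w / herm_inner q z y) y"
          have y': "y' \<in> K"
            using K y by (simp add: y'_def linear_code_def)
          have zy': "herm_inner q z y' = w"
            using nz z_words K_words[OF y] by (simp add: y'_def herm_inner_wscale_right[of _ ?N])
          have "\<delta> (wdot (map al z) (map be y') - wdot (map be z) (map al y')) = \<delta> t"
            using form[OF z_words K_words[OF y']] A.herm_inner_swap[OF z_words K_words[OF y']] w
            by (simp add: zy')
          then have "wdot (map al z) (map be y') = t + wdot (map be z) (map al y')"
            using \<delta>_inj by (metis diff_add_cancel injD)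
          moreover have "B.cocycle (\<Phi> y') (\<Phi> z) = B.cocycle (\<Phi> z) (\<Phi> y')"
            using contra y' \<Phi>z by auto
          ultimately have "add_char p r t * add_char p r (wdot (map be z) (map al y'))
              = add_char p r (wdot (map be z) (map al y'))"
            using cocycle_swap[OF z_words K_words[OF y']] by (simp add: cocycle_\<Phi> B.chi_add)
          then show ?thesis
            by simp
        qed
        then show False
          using B.chi_nontrivial[of 1] by simp
      qed
      then have "z \<in> ?Q"
        using z_words by (simp add: A.herm_dual_iff flip: dual_K)
      moreover have "z \<noteq> wzero ?N"
        using contra \<Phi>z by (auto simp: \<Phi>_def al0 be0)
      ultimately have "de_bound n f g h \<le> enat (hweight z)"
        by (intro de_bound_le_hweight) (use assms in simp_all)
      moreover have "z ! i \<noteq> 0 \<longleftrightarrow> (a ! i, b ! i) \<noteq> (0, 0)" if "i < ?N" for i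
        using z_nth[OF that] bij_coords[of "z ! i" 0] al0 be0 by (metis prod.inject)
      then have "{i. i < length z \<and> z ! i \<noteq> 0} = {i. i < ?N \<and> (a ! i, b ! i) \<noteq> (0, 0)}"
        using z_words by (auto simp: words_iff)
      then have "hweight z = error_weight ?N a b"
        by (simp only: hweight_def error_weight_def)
      ultimately show False
        using wt by simp
    qed
  qed
  moreover have "int ?N - int (2 * (degree f + degree g))
      = 2 * int n - 2 * int (degree f) - 2 * int (degree g)"
    by simp
  ultimately show "\<exists>C :: 'b list ket set. stabilizer_code p r ?N C \<and>
      has_parameters p r C ?N (2 * int n - 2 * int (degree f) - 2 * int (degree g)) (de_bound n f g h)"
    using S.stabilizer_code_code by metis
qed

end
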